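(* Let $n\ge 2$ and $m\ge 1$ be integers. Let $\ell_n(z,\bar z)=\bar z\,q(z)-p(z)$ with $p,q\in\mathbb C[z]$, $\deg q=n$, $\deg p\le n$, and suppose that all roots of $\ell_n$ in $\mathbb C$ are simple. Put $k=\rho(\ell_n)$, let $\alpha_1,\dots,\alpha_k$ be the roots of $\ell_n$, and let $\gamma\neq 0$ be the coefficient of $z^n$ in $q(z)$. For $t\in\mathbb C\setminus\{0\}$ define $$\phi_t(z,\bar z):=\frac{(t\bar z+\gamma)^m-\gamma^m}{\gamma^{m-1}\,m\,t}\,q(z)-p(z).$$ Then there is $t_0>0$ such that for every $t\in\mathbb C$ with $0<|t|<t_0$, all roots of $\phi_t$ are simple and $\rho(\phi_t)=k+m-1$. Furthermore, for such $t$ the roots of $\phi_t$ can be labelled $\alpha_1(t),\dots,\alpha_k(t),\beta_1(t),\dots,\beta_{m-1}(t)$ so that: (1) for each $j=1,\dots,k$, $\alpha_j(t)\to\alpha_j$ as $t\to 0$, and the sign of the root $\alpha_j(t)$ of $\phi_t$ is the same as the sign of the root $\alpha_j$ of $\ell_n$; (2) for each $a=1,\dots,m-1$, $|\beta_a(t)|\to\infty$ as $t\to 0$ (the root is born at infinity), and $\beta_a(t)$ is a negative root of $\phi_t$. In particular, taking $\ell_n$ to be Rhie's polynomial, which has $\rho(\ell_n)=5n-5$, one gets $\rho(\phi_t)=5n+m-6$ for all sufficiently small $t\neq 0$.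
   Context: A mixed polynomial of one variable is a polynomial expression $f(z,\bar z)=\sum_{\nu,\mu}a_{\nu,\mu}z^\nu\bar z^\mu$ with complex coefficients, viewed as a function of $z\in\mathbb C$; its roots are the points $z\in\mathbb C$ with $f(z,\bar z)=0$. Write $z=x+iy$ and $f=g+ih$ with $g=\Re f$, $h=\Im f$ as real functions of $(x,y)$. A root $\alpha$ of $f$ is a positive simple root (respectively a negative simple root) if the Jacobian determinant $J(g,h)=\partial(g,h)/\partial(x,y)$ is positive (respectively negative) at $\alpha$; it is simple if it is one of these two, and its sign is the sign of this Jacobian. For $f$ with only simple roots (finitely many), $\rho(f)$ denotes the number of roots of $f$ in $\mathbb C$, counted without sign. Rhie's polynomial: for each $n\ge 2$, Rhie gave an explicit polynomial of the form $\bar z q(z)-p(z)$ with $\deg q=n$, $\deg p\le n$, all of whose roots are simple and which has exactly $5n-5$ roots (the maximal possible number for this class, by Khavinson and Neumann). For $t\ne0$, $\phi_t$ is a generalized lens polynomial: up to a nonzero constant factor, in the coordinate $u=\bar t z+\bar\gamma$ it has the form $\bar u^m Q(u)-P(u)$ with $\deg Q=n$, $\deg P\le n$. *)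

theory Defs
  imports "HOL-Analysis.Analysis" "HOL-Computational_Algebra.Polynomial"
begin

text \<open>A mixed polynomial in \<open>z\<close> and \<open>cnj z\<close> is handled through the function of \<open>z\<close> that it
  induces, so the notions below take a function \<open>f :: complex \<Rightarrow> complex\<close>.\<close>

definition mixed_roots :: "(complex \<Rightarrow> complex) \<Rightarrow> complex set" where
  "mixed_roots f = {z. f z = 0}"

text \<open>The real Jacobian determinant \<open>g\<^sub>x h\<^sub>y - g\<^sub>y h\<^sub>x\<close>, where \<open>f = g + i h\<close> and \<open>z = x + i y\<close>.\<close>

definition mixed_jacobian :: "(complex \<Rightarrow> complex) \<Rightarrow> complex \<Rightarrow> real" where
  "mixed_jacobian f z =
     deriv (\<lambda>x. Re (f (Complex x (Im z)))) (Re z) * deriv (\<lambda>y. Im (f (Complex (Re z) y))) (Im z)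
   - deriv (\<lambda>y. Re (f (Complex (Re z) y))) (Im z) * deriv (\<lambda>x. Im (f (Complex x (Im z)))) (Re z)"

definition positive_simple_root :: "(complex \<Rightarrow> complex) \<Rightarrow> complex \<Rightarrow> bool" where
  "positive_simple_root f z \<longleftrightarrow> z \<in> mixed_roots f \<and> mixed_jacobian f z > 0"

definition negative_simple_root :: "(complex \<Rightarrow> complex) \<Rightarrow> complex \<Rightarrow> bool" where
  "negative_simple_root f z \<longleftrightarrow> z \<in> mixed_roots f \<and> mixed_jacobian f z < 0"

definition simple_root :: "(complex \<Rightarrow> complex) \<Rightarrow> complex \<Rightarrow> bool" where
  "simple_root f z \<longleftrightarrow> positive_simple_root f z \<or> negative_simple_root f z"

definition root_sign :: "(complex \<Rightarrow> complex) \<Rightarrow> complex \<Rightarrow> real" where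
  "root_sign f z = sgn (mixed_jacobian f z)"

definition all_roots_simple :: "(complex \<Rightarrow> complex) \<Rightarrow> bool" where
  "all_roots_simple f \<longleftrightarrow> (\<forall>z \<in> mixed_roots f. simple_root f z)"

text \<open>Only meaningful when there are finitely many roots, since \<open>card\<close> of an infinite set is 0.\<close>

definition root_count :: "(complex \<Rightarrow> complex) \<Rightarrow> nat" (\<open>\<rho>\<close>) where
  "\<rho> f = card (mixed_roots f)"

definition lens_poly :: "complex poly \<Rightarrow> complex poly \<Rightarrow> complex \<Rightarrow> complex" where
  "lens_poly p q z = cnj z * poly q z - poly p z"

text \<open>The deformation of \<open>lens_poly p q\<close>; the parameter \<open>\<gamma>\<close> is to be the leading coefficient
  of \<open>q\<close>.\<close>

definition lens_deform ::
    "nat \<Rightarrow> complex \<Rightarrow> complex poly \<Rightarrow> complex poly \<Rightarrow> complex \<Rightarrow> complex \<Rightarrow> complex" where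
  "lens_deform m \<gamma> p q t z =
     ((t * cnj z + \<gamma>) ^ m - \<gamma> ^ m) / (\<gamma> ^ (m - 1) * of_nat m * t) * poly q z - poly p z"

definition simple_lens :: "nat \<Rightarrow> complex poly \<Rightarrow> complex poly \<Rightarrow> bool" where
  "simple_lens n p q \<longleftrightarrow> degree q = n \<and> degree p \<le> n \<and> all_roots_simple (lens_poly p q)"

text \<open>Rhie's explicit examples enter only through these properties, so the predicate
  covers every polynomial that has them.\<close>

definition rhie_lens :: "nat \<Rightarrow> complex poly \<Rightarrow> complex poly \<Rightarrow> bool" where
  "rhie_lens n p q \<longleftrightarrow>
     simple_lens n p q \<and> finite (mixed_roots (lens_poly p q)) \<and> \<rho> (lens_poly p q) = 5 * n - 5"

end

theory Submission
  imports Defs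
begin

text \<open>
  Write \<open>\<phi>\<^sub>t(z) = cnj z * S(t * cnj z) * q(z) - p(z)\<close> with a polynomial \<open>S\<close> satisfying \<open>S(0) = 1\<close>; this
  also makes sense at \<open>t = 0\<close>, where it is the given lens polynomial. Near a simple root of the
  latter, a quantitative inverse function argument (a contraction) gives exactly one root of
  \<open>\<phi>\<^sub>t\<close>, with the same sign. For large \<open>|z|\<close> the quotient \<open>p/q\<close> is bounded, so at a root the
  quantity \<open>U = t * cnj z\<close> must be close to some \<open>V\<close> with \<open>(V + \<gamma>)\<^sup>m = \<gamma>\<^sup>m\<close>, and \<open>V = 0\<close> is
  excluded by boundedness. Near each of the \<open>m - 1\<close> values \<open>V \<noteq> 0\<close> the same contraction argument,
  applied to \<open>\<phi>\<^sub>t/q\<close> on a disc of radius \<open>\<delta>/|t|\<close>, yields exactly one root; it is negative since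
  \<open>(p/q)'\<close> tends to 0 at infinity while the derivative in \<open>cnj z\<close> has modulus close to 1.
  Compactness shows that there are no further roots.

  For the maximal examples, \<open>z\<^sup>N\<close> is forced to be real at every root, so that the roots lie on
  finitely many rays and can be counted by real analysis in \<open>s = |z|\<close>. In degree \<open>N + 1 \<ge> 4\<close>
  the equation is \<open>\<plusminus> s\<^sup>N (s\<^sup>2 - 2) = s\<^sup>2/2 - 1/1024\<close>, where Rolle's theorem bounds the number of
  positive solutions by 2 and 3, respectively, and sign changes produce that many.
\<close>

section \<open>Wirtinger derivatives and isolated zeros\<close>

text \<open>Here \<open>a\<close> and \<open>b\<close> are the derivatives of \<open>f\<close> with
  respect to z and to its conjugate. Asking for the full real derivative, not just partial
  derivatives, makes the chain and product rules available.\<close>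

definition has_wirtinger ::
    "(complex \<Rightarrow> complex) \<Rightarrow> complex \<Rightarrow> complex \<Rightarrow> complex \<Rightarrow> bool" where
  "has_wirtinger f a b z \<longleftrightarrow> (f has_derivative (\<lambda>h. a * h + b * cnj h)) (at z)"

lemma has_wirtinger_holomorphic:
  "(f has_field_derivative D) (at z) \<Longrightarrow> has_wirtinger f D 0 z"
  by (simp add: has_wirtinger_def has_field_derivative_def)

lemma has_wirtinger_antiholomorphic:
  assumes "(f has_field_derivative D) (at (cnj z))"
  shows "has_wirtinger (\<lambda>z. f (cnj z)) 0 D z"
proof -
  have "(cnj has_derivative cnj) (at z)"
    by (rule bounded_linear_imp_has_derivative[OF bounded_linear_cnj])
  moreover have "(f has_derivative (\<lambda>h. D * h)) (at (cnj z))"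
    using assms by (simp add: has_field_derivative_def)
  ultimately have "((\<lambda>z. f (cnj z)) has_derivative (\<lambda>h. D * cnj h)) (at z)"
    by (rule has_derivative_compose)
  then show ?thesis by (simp add: has_wirtinger_def)
qed

lemma has_wirtinger_diff:
  assumes "has_wirtinger f a b z" "has_wirtinger g c d z"
  shows "has_wirtinger (\<lambda>z. f z - g z) (a - c) (b - d) z"
  using has_derivative_diff[OF assms[unfolded has_wirtinger_def]]
  by (simp add: has_wirtinger_def algebra_simps)

lemma has_wirtinger_mult:
  assumes "has_wirtinger f a b z" "has_wirtinger g c d z"
  shows "has_wirtinger (\<lambda>z. f z * g z) (a * g z + f z * c) (b * g z + f z * d) z"
  using has_derivative_mult[OF assms[unfolded has_wirtinger_def]]
  by (simp add: has_wirtinger_def algebra_simps)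

text \<open>Restricting the derivative to the two axes gives f_x = a + b and f_y = i (a - b), and
  the Jacobian is the imaginary part of f_y times the conjugate of f_x.\<close>

lemma mixed_jacobian_wirtinger:
  assumes "has_wirtinger f a b z"
  shows "mixed_jacobian f z = (norm a)\<^sup>2 - (norm b)\<^sup>2"
proof -
  have f: "(f has_derivative (\<lambda>h. a * h + b * cnj h)) (at (Complex (Re z) (Im z)))"
    using assms by (simp add: has_wirtinger_def)
  have cx: "((\<lambda>x. Complex x (Im z)) has_derivative (\<lambda>h. Complex h 0)) (at (Re z))"
  proof -
    have "((\<lambda>x. of_real x + \<i> * of_real (Im z)) has_derivative (\<lambda>h. of_real h + 0)) (at (Re z))"
      by (auto intro!: derivative_eq_intros)
    then show ?thesis by (simp add: Complex_eq)
  qed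
  have cy: "((\<lambda>y. Complex (Re z) y) has_derivative (\<lambda>h. Complex 0 h)) (at (Im z))"
  proof -
    have "((\<lambda>y. of_real (Re z) + \<i> * of_real y) has_derivative (\<lambda>h. 0 + \<i> * of_real h)) (at (Im z))"
      by (auto intro!: derivative_eq_intros)
    then show ?thesis by (simp add: Complex_eq)
  qed
  note fx = has_derivative_compose[OF cx f] and fy = has_derivative_compose[OF cy f]
  have 1: "deriv (\<lambda>x. Re (f (Complex x (Im z)))) (Re z) = Re (a + b)"
    by (rule DERIV_imp_deriv, unfold has_field_derivative_def,
        rule has_derivative_eq_rhs[OF has_derivative_Re[OF fx]]) (auto simp: algebra_simps)
  have 2: "deriv (\<lambda>x. Im (f (Complex x (Im z)))) (Re z) = Im (a + b)"
    by (rule DERIV_imp_deriv, unfold has_field_derivative_def,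
        rule has_derivative_eq_rhs[OF has_derivative_Im[OF fx]]) (auto simp: algebra_simps)
  have 3: "deriv (\<lambda>y. Re (f (Complex (Re z) y))) (Im z) = Im b - Im a"
    by (rule DERIV_imp_deriv, unfold has_field_derivative_def,
        rule has_derivative_eq_rhs[OF has_derivative_Re[OF fy]]) (auto simp: algebra_simps)
  have 4: "deriv (\<lambda>y. Im (f (Complex (Re z) y))) (Im z) = Re a - Re b"
    by (rule DERIV_imp_deriv, unfold has_field_derivative_def,
        rule has_derivative_eq_rhs[OF has_derivative_Im[OF fy]]) (auto simp: algebra_simps)
  show ?thesis
    unfolding mixed_jacobian_def 1 2 3 4
    by (simp add: cmod_power2) (simp add: algebra_simps power2_eq_square)
qed

lemma simple_root_iff:
  "simple_root f z \<longleftrightarrow> f z = 0 \<and> mixed_jacobian f z \<noteq> 0"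
  by (auto simp: simple_root_def positive_simple_root_def negative_simple_root_def mixed_roots_def)

text \<open>Newton's iteration with a frozen derivative is a contraction: the real-linear map h ->
  \<open>a0 * h + b0 * cnj h\<close> shrinks no vector by more than the factor
  \<open>\<kappa>\<close>. The centre \<open>c\<close> need not be a zero, and \<open>a0\<close>,
  \<open>b0\<close> need not be the derivatives at \<open>c\<close>, so the same lemma serves the
  bounded roots and the growing discs that move to infinity.\<close>

lemma wirtinger_unique_zero:
  assumes der: "\<And>z. z \<in> cball c d \<Longrightarrow> has_wirtinger f (a z) (b z) z"
    and \<kappa>: "\<kappa> = \<bar>norm a0 - norm b0\<bar>" "\<kappa> > 0"
    and a: "\<And>z. z \<in> cball c d \<Longrightarrow> norm (a z - a0) \<le> \<kappa> / 4"
    and b: "\<And>z. z \<in> cball c d \<Longrightarrow> norm (b z - b0) \<le> \<kappa> / 4"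
    and d: "d \<ge> 0" and fc: "norm (f c) \<le> \<kappa> * d / 4"
  shows "\<exists>!z. z \<in> cball c d \<and> f z = 0"
    and "\<And>z. z \<in> cball c d \<Longrightarrow> f z = 0 \<Longrightarrow> norm (z - c) \<le> 2 / \<kappa> * norm (f c)"
    and "\<And>z. z \<in> cball c d \<Longrightarrow> sgn (mixed_jacobian f z) = sgn ((norm a0)\<^sup>2 - (norm b0)\<^sup>2)"
proof -
  define N where "N = (norm a0)\<^sup>2 - (norm b0)\<^sup>2"
  have N_factor: "N = (norm a0 - norm b0) * (norm a0 + norm b0)"
    by (simp add: N_def power2_eq_square algebra_simps)
  have pos: "norm a0 + norm b0 > 0"
    using \<kappa> norm_ge_zero[of a0] norm_ge_zero[of b0] by linarith
  have absN: "\<bar>N\<bar> = \<kappa> * (norm a0 + norm b0)"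
    using pos by (simp add: N_factor abs_mult \<kappa>)
  have N: "N \<noteq> 0" using absN \<kappa>(2) pos by auto
  \<comment> \<open>\<open>L\<close> inverts h -> \<open>a0 * h + b0 * cnj h\<close>: eliminating
    \<open>cnj h\<close> between the image and its conjugate leaves h times
    \<open>N\<close>.\<close>
  define L where "L w = (cnj a0 * w - b0 * cnj w) / of_real N" for w
  have L_lin: "bounded_linear L"
    unfolding L_def
    by (intro bounded_linear_divide[THEN bounded_linear_compose] bounded_linear_sub
        bounded_linear_const_mult bounded_linear_cnj bounded_linear_ident)
  have L_inv: "L (a0 * h + b0 * cnj h) = h" for h
  proof -
    have "cnj a0 * (a0 * h + b0 * cnj h) - b0 * cnj (a0 * h + b0 * cnj h)
        = (a0 * cnj a0 - b0 * cnj b0) * h"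
      by (simp add: algebra_simps)
    also have "a0 * cnj a0 - b0 * cnj b0 = of_real N"
      by (simp add: N_def complex_norm_square[symmetric])
    finally show ?thesis using N by (simp add: L_def)
  qed
  have L_norm: "norm (L w) \<le> norm w / \<kappa>" for w
  proof -
    have "norm (cnj a0 * w - b0 * cnj w) \<le> (norm a0 + norm b0) * norm w"
      by (rule order_trans[OF norm_triangle_ineq4]) (simp add: norm_mult algebra_simps)
    then have "norm (L w) \<le> (norm a0 + norm b0) * norm w / \<bar>N\<bar>"
      by (simp add: L_def norm_divide divide_right_mono)
    also have "\<dots> = norm w / \<kappa>" using absN pos \<kappa>(2) by simp
    finally show ?thesis .
  qed
  have L0: "L w = 0 \<longleftrightarrow> w = 0" for w
  proof
    assume "L w = 0"
    then have e: "cnj a0 * w = b0 * cnj w" using N by (simp add: L_def)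
    then have "norm (cnj a0 * w) = norm (b0 * cnj w)" by simp
    then show "w = 0" using \<kappa> by (auto simp: norm_mult)
  qed (simp add: L_def)
  define T where "T z = z - L (f z)" for z
  have Tder: "(T has_derivative (\<lambda>h. L ((a0 - a z) * h + (b0 - b z) * cnj h))) (at z within cball c d)"
    if z: "z \<in> cball c d" for z
  proof -
    have "(f has_derivative (\<lambda>h. a z * h + b z * cnj h)) (at z within cball c d)"
      using der[OF z] unfolding has_wirtinger_def by (rule has_derivative_at_withinI)
    from bounded_linear.has_derivative[OF L_lin this]
    have "(T has_derivative (\<lambda>h. h - L (a z * h + b z * cnj h))) (at z within cball c d)"
      unfolding T_def by (intro has_derivative_diff has_derivative_ident)
    moreover have "h - L (a z * h + b z * cnj h) = L ((a0 - a z) * h + (b0 - b z) * cnj h)" for h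
    proof -
      have "h - L (a z * h + b z * cnj h) = L (a0 * h + b0 * cnj h) - L (a z * h + b z * cnj h)"
        by (simp add: L_inv)
      also have "\<dots> = L ((a0 - a z) * h + (b0 - b z) * cnj h)"
        by (simp add: linear_diff[OF bounded_linear.linear[OF L_lin], symmetric] algebra_simps)
      finally show ?thesis .
    qed
    ultimately show ?thesis by simp
  qed
  \<comment> \<open>Both coefficients are off by at most \<open>\<kappa> / 4\<close>, and
    \<open>L\<close> has norm at most \<open>1 / \<kappa>\<close>; together this is the factor
    1/2.\<close>
  have on: "onorm (\<lambda>h. L ((a0 - a z) * h + (b0 - b z) * cnj h)) \<le> 1 / 2"
    if z: "z \<in> cball c d" for z
  proof (rule onorm_le)
    fix h
    have "norm ((a0 - a z) * h + (b0 - b z) * cnj h) \<le> norm (a z - a0) * norm h + norm (b z - b0) * norm h"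
      by (rule order_trans[OF norm_triangle_ineq]) (simp add: norm_mult norm_minus_commute)
    also have "\<dots> \<le> \<kappa> / 4 * norm h + \<kappa> / 4 * norm h"
      by (intro add_mono mult_right_mono a b z) auto
    finally have "norm ((a0 - a z) * h + (b0 - b z) * cnj h) / \<kappa> \<le> 1 / 2 * norm h"
      using \<kappa>(2) by (simp add: field_simps)
    then show "norm (L ((a0 - a z) * h + (b0 - b z) * cnj h)) \<le> 1 / 2 * norm h"
      using L_norm order_trans by blast
  qed
  have contr: "norm (T x - T y) \<le> 1 / 2 * norm (x - y)" if "x \<in> cball c d" "y \<in> cball c d" for x y
    by (rule differentiable_bound[OF convex_cball Tder on that])
  have Tc: "norm (T c - c) \<le> norm (f c) / \<kappa>"
    using L_norm[of "f c"] by (simp add: T_def)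
  have Tmaps: "T ` cball c d \<subseteq> cball c d"
  proof safe
    fix x assume x: "x \<in> cball c d"
    have "norm (T x - c) \<le> norm (T x - T c) + norm (T c - c)"
      using norm_triangle_ineq[of "T x - T c" "T c - c"] by simp
    also have "\<dots> \<le> 1/2 * norm (x - c) + norm (f c) / \<kappa>"
      by (intro add_mono contr Tc x) (use d in auto)
    also have "norm (f c) / \<kappa> \<le> d / 4" using fc \<kappa>(2) by (simp add: field_simps)
    finally show "T x \<in> cball c d" using x d by (simp add: dist_norm norm_minus_commute)
  qed
  have fix_iff: "T x = x \<longleftrightarrow> f x = 0" for x by (simp add: T_def L0)
  have "\<exists>!x. x \<in> cball c d \<and> T x = x"
    using Banach_fix[of "cball c d" "1/2" T] d Tmaps contr
    by (auto simp: dist_norm complete_eq_closed)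
  then show "\<exists>!z. z \<in> cball c d \<and> f z = 0" by (simp add: fix_iff)
  show "norm (z - c) \<le> 2 / \<kappa> * norm (f c)" if z: "z \<in> cball c d" "f z = 0" for z
  proof -
    have "T z = z" using z fix_iff by simp
    then have "norm (z - c) \<le> norm (T z - T c) + norm (T c - c)"
      using norm_triangle_ineq[of "T z - T c" "T c - c"] by simp
    also have "\<dots> \<le> 1/2 * norm (z - c) + norm (f c) / \<kappa>"
      by (intro add_mono contr Tc z) (use d in auto)
    finally show ?thesis by simp
  qed
  show "sgn (mixed_jacobian f z) = sgn ((norm a0)\<^sup>2 - (norm b0)\<^sup>2)" if z: "z \<in> cball c d" for z
  proof -
    have J: "mixed_jacobian f z = (norm (a z) - norm (b z)) * (norm (a z) + norm (b z))"
      using mixed_jacobian_wirtinger[OF der[OF z]] by (simp add: power2_eq_square algebra_simps)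
    \<comment> \<open>The two moduli move by at most \<open>\<kappa> / 4\<close> each, so their
      difference, which has size \<open>\<kappa>\<close> at the reference pair, keeps its
      sign.\<close>
    have 1: "\<bar>norm (a z) - norm a0\<bar> \<le> \<kappa> / 4" "\<bar>norm (b z) - norm b0\<bar> \<le> \<kappa> / 4"
      using a[OF z] b[OF z] norm_triangle_ineq3[of "a z" a0] norm_triangle_ineq3[of "b z" b0] by linarith+
    have ne: "norm (a z) - norm (b z) \<noteq> 0"
      using 1 \<kappa> by linarith
    then have "norm (a z) + norm (b z) > 0"
      using norm_ge_zero[of "a z"] norm_ge_zero[of "b z"] by linarith
    moreover have "sgn (norm (a z) - norm (b z)) = sgn (norm a0 - norm b0)"
    proof (cases "norm a0 > norm b0")
      case True
      with 1 \<kappa> have "norm (a z) - norm (b z) > 0" by linarith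
      with True show ?thesis by simp
    next
      case False
      with 1 \<kappa> have "norm (a z) - norm (b z) < 0" "norm a0 - norm b0 < 0" by linarith+
      then show ?thesis by simp
    qed
    ultimately show ?thesis
      using pos by (simp add: J N_factor[unfolded N_def] sgn_mult)
  qed
qed

lemma wirtinger_lens:
  "has_wirtinger (lens_poly p q) (cnj z * poly (pderiv q) z - poly (pderiv p) z) (poly q z) z"
proof -
  have "has_wirtinger cnj 0 1 z"
    using has_wirtinger_antiholomorphic[OF DERIV_ident] .
  then have "has_wirtinger (\<lambda>z. cnj z * poly q z - poly p z)
      (0 * poly q z + cnj z * poly (pderiv q) z - poly (pderiv p) z)
      (1 * poly q z + cnj z * 0 - 0) z"
    by (intro has_wirtinger_diff has_wirtinger_mult has_wirtinger_holomorphic poly_DERIV)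
  then show ?thesis by (simp add: lens_poly_def[abs_def])
qed

section \<open>Roots of the deformed lens polynomial\<close>

lemma poly_norm_upper:
  fixes p :: "complex poly"
  assumes "degree p \<le> n"
  obtains C where "C \<ge> 0" "\<And>z. norm z \<ge> 1 \<Longrightarrow> norm (poly p z) \<le> C * norm z ^ n"
proof
  show "(\<Sum>i\<le>degree p. norm (coeff p i)) \<ge> 0" by (simp add: sum_nonneg)
  fix z :: complex assume z: "norm z \<ge> 1"
  have "norm (poly p z) \<le> (\<Sum>i\<le>degree p. norm (coeff p i * z ^ i))"
    unfolding poly_altdef by (rule norm_sum)
  also have "\<dots> \<le> (\<Sum>i\<le>degree p. norm (coeff p i) * norm z ^ n)"
    using z assms by (intro sum_mono) (auto simp: norm_mult norm_power intro!: mult_left_mono power_increasing)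
  finally show "norm (poly p z) \<le> (\<Sum>i\<le>degree p. norm (coeff p i)) * norm z ^ n"
    by (simp add: sum_distrib_right)
qed

lemma poly_norm_lower:
  fixes q :: "complex poly"
  assumes "q \<noteq> 0" "degree q = n"
  obtains R where "\<And>z. norm z \<ge> R \<Longrightarrow> norm (poly q z) \<ge> norm (coeff q n) / 2 * norm z ^ n"
proof
  define C where "C = (\<Sum>i<n. norm (coeff q i))"
  have lc: "norm (coeff q n) > 0" using assms by auto
  fix z :: complex assume z: "norm z \<ge> max 1 (2 * C / norm (coeff q n))"
  \<comment> \<open>The lower terms are of order n - 1. Multiplying by \<open>norm z\<close> first
    compares them with the n-th power without subtracting in the exponent, which also covers n =
    0.\<close>
  have "norm z * norm (\<Sum>i<n. coeff q i * z ^ i) \<le> norm z * (\<Sum>i<n. norm (coeff q i * z ^ i))"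
    by (intro mult_left_mono norm_sum) auto
  also have "\<dots> = (\<Sum>i<n. norm (coeff q i) * norm z ^ Suc i)"
    by (simp add: sum_distrib_left norm_mult norm_power mult_ac)
  also have "\<dots> \<le> (\<Sum>i<n. norm (coeff q i) * norm z ^ n)"
    using z by (intro sum_mono mult_left_mono power_increasing) auto
  also have "\<dots> = C * norm z ^ n" by (simp add: C_def sum_distrib_right)
  also have "\<dots> \<le> norm z * norm (coeff q n) / 2 * norm z ^ n"
    using z lc by (intro mult_right_mono) (auto simp: field_simps)
  finally have "norm z * norm (\<Sum>i<n. coeff q i * z ^ i) \<le> norm z * (norm (coeff q n) / 2 * norm z ^ n)"
    by simp
  then have low: "norm (\<Sum>i<n. coeff q i * z ^ i) \<le> norm (coeff q n) / 2 * norm z ^ n"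
    using z by (subst (asm) mult_le_cancel_left_pos) auto
  have "poly q z = coeff q n * z ^ n + (\<Sum>i<n. coeff q i * z ^ i)"
    using assms by (simp add: poly_altdef lessThan_Suc_atMost[symmetric])
  then have "norm (poly q z) \<ge> norm (coeff q n * z ^ n) - norm (\<Sum>i<n. coeff q i * z ^ i)"
    using norm_diff_ineq by metis
  with low show "norm (poly q z) \<ge> norm (coeff q n) / 2 * norm z ^ n"
    by (simp add: norm_mult norm_power)
qed

text \<open>The polynomial is z p'(z). That it has the same degree bound as p is what makes z
  (p/q)'(z) bounded at infinity. Constant p needs its own case because \<open>degree\<close> is
  truncated at 0.\<close>

lemma degree_pCons_pderiv_le:
  fixes p :: "complex poly"
  assumes "degree p \<le> n"
  shows "degree (pCons 0 (pderiv p)) \<le> n"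
proof (cases "degree p = 0")
  case True
  then have "pderiv p = 0" by (simp add: pderiv_eq_0_iff)
  then show ?thesis by simp
next
  case False
  then show ?thesis using assms degree_pCons_le[of 0 "pderiv p"] by (simp add: degree_pderiv)
qed

text \<open>Numerators and denominators are compared with the same power of \<open>norm z\<close>.
  For the derivative this is done after multiplying by z, whence the decay
  \<open>C' / norm z\<close>.\<close>

lemma rational_bounds:
  fixes p q :: "complex poly"
  assumes q: "q \<noteq> 0" "degree q = n" and p: "degree p \<le> n"
  obtains R C C' where "R > 0" "C > 0" "C' > 0"
    "\<And>z. norm z \<ge> R \<Longrightarrow> poly q z \<noteq> 0"
    "\<And>z. norm z \<ge> R \<Longrightarrow> norm (poly p z / poly q z) \<le> C"
    "\<And>z. norm z \<ge> R \<Longrightarrow>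
       norm ((poly (pderiv p) z * poly q z - poly p z * poly (pderiv q) z) / (poly q z)\<^sup>2) \<le> C' / norm z"
proof -
  obtain R0 where R0: "\<And>z. norm z \<ge> R0 \<Longrightarrow> norm (poly q z) \<ge> norm (coeff q n) / 2 * norm z ^ n"
    using poly_norm_lower[OF q] by blast
  obtain Cp where Cp: "Cp \<ge> 0" "\<And>z. norm z \<ge> 1 \<Longrightarrow> norm (poly p z) \<le> Cp * norm z ^ n"
    using poly_norm_upper[OF p] by blast
  obtain Cq where Cq: "Cq \<ge> 0" "\<And>z. norm z \<ge> 1 \<Longrightarrow> norm (poly q z) \<le> Cq * norm z ^ n"
    using poly_norm_upper[of q n] q by auto
  obtain Dp where Dp: "Dp \<ge> 0" "\<And>z. norm z \<ge> 1 \<Longrightarrow> norm (z * poly (pderiv p) z) \<le> Dp * norm z ^ n"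
    using poly_norm_upper[OF degree_pCons_pderiv_le[OF p]] by auto
  obtain Dq where Dq: "Dq \<ge> 0" "\<And>z. norm z \<ge> 1 \<Longrightarrow> norm (z * poly (pderiv q) z) \<le> Dq * norm z ^ n"
    using poly_norm_upper[OF degree_pCons_pderiv_le[of q n]] q by auto
  define g where "g = norm (coeff q n) / 2"
  have g: "g > 0" using q by (auto simp: g_def)
  show ?thesis
  proof
    \<comment> \<open>The added 1 keeps the constants strictly positive even when p = 0.\<close>
    show "max 1 R0 > 0" "Cp / g + 1 > 0" "(Dp * Cq + Cp * Dq) / g\<^sup>2 + 1 > 0"
      using g Cp(1) Cq(1) Dp(1) Dq(1) by (auto simp: add_nonneg_pos)
    fix z :: complex assume "norm z \<ge> max 1 R0"
    then have z: "norm z \<ge> 1" "norm z \<ge> R0" by auto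
    define Z where "Z = norm z ^ n"
    have "norm z > 0" using z by linarith
    then have Z: "Z > 0" by (simp add: Z_def)
    have low: "norm (poly q z) \<ge> g * Z" using R0[OF z(2)] by (simp add: g_def Z_def)
    then have qpos: "norm (poly q z) > 0" using g Z by (meson less_le_trans mult_pos_pos)
    then show "poly q z \<noteq> 0" by simp
    have "norm (poly p z / poly q z) \<le> Cp * Z / (g * Z)"
      unfolding norm_divide using Cp(2)[OF z(1)] low g Z Cp(1) by (intro frac_le) (auto simp: Z_def)
    then show "norm (poly p z / poly q z) \<le> Cp / g + 1" using Z by simp
    define w where "w = poly (pderiv p) z * poly q z - poly p z * poly (pderiv q) z"
    have "norm (z * w) = norm ((z * poly (pderiv p) z) * poly q z - poly p z * (z * poly (pderiv q) z))"
      by (simp add: w_def algebra_simps)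
    also have "\<dots> \<le> norm (z * poly (pderiv p) z) * norm (poly q z) + norm (poly p z) * norm (z * poly (pderiv q) z)"
      by (rule order_trans[OF norm_triangle_ineq4]) (simp add: norm_mult)
    also have "\<dots> \<le> (Dp * Z) * (Cq * Z) + (Cp * Z) * (Dq * Z)"
      using Cp Cq Dp Dq z Z by (intro add_mono mult_mono) (auto simp: Z_def)
    also have "\<dots> = (Dp * Cq + Cp * Dq) * Z\<^sup>2" by (simp add: algebra_simps power2_eq_square)
    finally have zw: "norm (z * w) \<le> (Dp * Cq + Cp * Dq) * Z\<^sup>2" .
    have "norm (z * w / (poly q z)\<^sup>2) \<le> (Dp * Cq + Cp * Dq) * Z\<^sup>2 / (g * Z)\<^sup>2"
      unfolding norm_divide norm_power using zw low g Z Cp(1) Cq(1) Dp(1) Dq(1)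
      by (intro frac_le power_mono) auto
    also have "\<dots> \<le> (Dp * Cq + Cp * Dq) / g\<^sup>2 + 1" using Z by (simp add: power_mult_distrib)
    finally have "norm z * norm (w / (poly q z)\<^sup>2) \<le> (Dp * Cq + Cp * Dq) / g\<^sup>2 + 1"
      by (simp add: norm_mult norm_divide)
    then show "norm (w / (poly q z)\<^sup>2) \<le> ((Dp * Cq + Cp * Dq) / g\<^sup>2 + 1) / norm z"
      using z by (subst pos_le_divide_eq) (auto simp: mult.commute)
  qed
qed

section \<open>Compactness, and selection of one zero per region\<close>

lemma continuous_nonzero_lower_bound:
  fixes f :: "complex \<Rightarrow> complex"
  assumes "compact K" "continuous_on K f" "\<And>z. z \<in> K \<Longrightarrow> f z \<noteq> 0"
  shows "\<exists>\<mu>>0. \<forall>z\<in>K. norm (f z) \<ge> \<mu>"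
proof (cases "K = {}")
  case True
  then show ?thesis by (auto intro: exI[of _ 1])
next
  case False
  then obtain x where "x \<in> K" "\<And>z. z \<in> K \<Longrightarrow> norm (f x) \<le> norm (f z)"
    using continuous_attains_inf[OF assms(1) False continuous_on_norm[OF assms(2)]] by auto
  then show ?thesis using assms(3) by (intro exI[of _ "norm (f x)"]) auto
qed

lemma bij_betw_unique_zeros:
  assumes ex: "\<And>i. i \<in> I \<Longrightarrow> \<exists>!x. x \<in> D i \<and> x \<in> X"
    and cover: "X \<subseteq> (\<Union>i\<in>I. D i)"
    and disj: "\<And>i j. i \<in> I \<Longrightarrow> j \<in> I \<Longrightarrow> i \<noteq> j \<Longrightarrow> D i \<inter> D j = {}"
  shows "bij_betw (\<lambda>i. THE x. x \<in> D i \<and> x \<in> X) I X"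
proof -
  have the: "(THE x. x \<in> D i \<and> x \<in> X) \<in> D i \<and> (THE x. x \<in> D i \<and> x \<in> X) \<in> X" if "i \<in> I" for i
    using theI'[OF ex[OF that]] .
  show ?thesis unfolding bij_betw_def
  proof (intro conjI subset_antisym)
    show "inj_on (\<lambda>i. THE x. x \<in> D i \<and> x \<in> X) I"
    proof (rule inj_onI)
      fix i j assume ij: "i \<in> I" "j \<in> I"
        "(THE x. x \<in> D i \<and> x \<in> X) = (THE x. x \<in> D j \<and> x \<in> X)"
      then show "i = j" using the[of i] the[of j] disj[of i j] by auto
    qed
    show "(\<lambda>i. THE x. x \<in> D i \<and> x \<in> X) ` I \<subseteq> X" using the by auto
    show "X \<subseteq> (\<lambda>i. THE x. x \<in> D i \<and> x \<in> X) ` I"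
    proof
      fix x assume x: "x \<in> X"
      then obtain i where i: "i \<in> I" "x \<in> D i" using cover by auto
      then have "(THE x. x \<in> D i \<and> x \<in> X) = x" using ex[OF i(1)] x the[OF i(1)] by auto
      then show "x \<in> (\<lambda>i. THE x. x \<in> D i \<and> x \<in> X) ` I" using i by force
    qed
  qed
qed

text \<open>All local statements below have the shape "for small \<delta>, then for t small
  depending on \<delta>". This shape survives finite conjunctions, so one \<delta> can be fixed for
  all roots at once.\<close>

lemma eventually_eventually_ball_finite:
  assumes "finite A" "\<And>y. y \<in> A \<Longrightarrow> \<forall>\<^sub>F s in F. \<forall>\<^sub>F t in G. P s t y"
  shows "\<forall>\<^sub>F s in F. \<forall>\<^sub>F t in G. \<forall>y\<in>A. P s t y"
  using assms by (simp add: eventually_ball_finite_distrib)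

section \<open>The deformed family, extended to t = 0, and its Wirtinger derivatives\<close>

locale lens_deformation =
  fixes n m :: nat and p q :: "complex poly" and \<gamma> :: complex
  assumes m: "m \<ge> 1" and deg_q: "degree q = n" and deg_p: "degree p \<le> n"
    and q0: "q \<noteq> 0" and \<gamma>: "\<gamma> = coeff q n"
begin

lemma \<gamma>0: "\<gamma> \<noteq> 0"
  using q0 deg_q \<gamma> by auto

text \<open>The quotient of \<open>(U + \<gamma>) ^ m - \<gamma> ^ m\<close> by
  \<open>\<gamma> ^ (m - 1) * of_nat m * U\<close>, written as a geometric sum so that it makes
  sense at U = 0.\<close>

definition S :: "complex \<Rightarrow> complex" where
  "S U = (\<Sum>i<m. \<gamma> ^ (m - Suc i) * (U + \<gamma>) ^ i) / (\<gamma> ^ (m - 1) * of_nat m)"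

text \<open>The derivative of U -> \<open>U * S U\<close>. It has modulus 1 wherever
  \<open>(U + \<gamma>) / \<gamma>\<close> does, in particular at the solutions of
  \<open>(U + \<gamma>) ^ m = \<gamma> ^ m\<close>.\<close>

definition E :: "complex \<Rightarrow> complex" where
  "E U = ((U + \<gamma>) / \<gamma>) ^ (m - 1)"

text \<open>Agrees with \<open>lens_deform\<close> for t \<noteq> 0 but is continuous across t = 0,
  where \<open>lens_deform\<close> divides by zero and collapses to
  \<open>- poly p z\<close>.\<close>

definition \<Phi> :: "complex \<Rightarrow> complex \<Rightarrow> complex" where
  "\<Phi> t z = cnj z * S (t * cnj z) * poly q z - poly p z"

lemma U_S: "U * S U = ((U + \<gamma>) ^ m - \<gamma> ^ m) / (\<gamma> ^ (m - 1) * of_nat m)"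
  using power_diff_sumr2[of "U + \<gamma>" m \<gamma>] by (simp add: S_def)

lemma S_0: "S 0 = 1"
proof -
  have "(\<Sum>i<m. \<gamma> ^ (m - Suc i) * \<gamma> ^ i) = (\<Sum>i<m. \<gamma> ^ (m - 1))"
    by (intro sum.cong) (auto simp flip: power_add)
  then show ?thesis using m \<gamma>0 by (simp add: S_def)
qed

lemma E_0: "E 0 = 1"
  using \<gamma>0 by (simp add: E_def)

lemma continuous_S [continuous_intros]: "continuous_on A g \<Longrightarrow> continuous_on A (\<lambda>x. S (g x))"
  unfolding S_def using m \<gamma>0 by (intro continuous_intros) auto

lemma continuous_E [continuous_intros]: "continuous_on A g \<Longrightarrow> continuous_on A (\<lambda>x. E (g x))"
  unfolding E_def using \<gamma>0 by (intro continuous_intros) auto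

lemma \<Phi>_deform:
  assumes "t \<noteq> 0"
  shows "lens_deform m \<gamma> p q t = \<Phi> t"
proof
  fix z
  have "((t * cnj z + \<gamma>) ^ m - \<gamma> ^ m) / (\<gamma> ^ (m - 1) * of_nat m * t) = (t * cnj z) * S (t * cnj z) / t"
    by (simp add: U_S)
  also have "\<dots> = cnj z * S (t * cnj z)" using assms by simp
  finally show "lens_deform m \<gamma> p q t z = \<Phi> t z" by (simp add: lens_deform_def \<Phi>_def)
qed

lemma \<Phi>_0: "\<Phi> 0 = lens_poly p q"
  by (simp add: fun_eq_iff \<Phi>_def S_0 lens_poly_def)

text \<open>The function depends on \<open>cnj z\<close> alone. Its closed form divides by t, and
  this t cancels against the inner derivative; t = 0 is therefore treated apart.\<close>

lemma wirtinger_cnj_S: "has_wirtinger (\<lambda>z. cnj z * S (t * cnj z)) 0 (E (t * cnj z)) z"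
proof (cases "t = 0")
  case True
  then show ?thesis
    using has_wirtinger_antiholomorphic[OF DERIV_ident] by (simp add: S_0 E_0)
next
  case False
  have eq: "(\<lambda>z. cnj z * S (t * cnj z))
      = (\<lambda>z. (\<lambda>w. ((t * w + \<gamma>) ^ m - \<gamma> ^ m) / (\<gamma> ^ (m - 1) * of_nat m * t)) (cnj z))"
  proof
    fix z
    have "cnj z * S (t * cnj z) = (t * cnj z) * S (t * cnj z) / t" using False by simp
    then show "cnj z * S (t * cnj z) =
        ((t * cnj z + \<gamma>) ^ m - \<gamma> ^ m) / (\<gamma> ^ (m - 1) * of_nat m * t)"
      by (simp only: U_S divide_divide_eq_left)
  qed
  have "((\<lambda>w. ((t * w + \<gamma>) ^ m - \<gamma> ^ m) / (\<gamma> ^ (m - 1) * of_nat m * t)) has_field_derivative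
      of_nat m * (t * w + \<gamma>) ^ (m - 1) * t / (\<gamma> ^ (m - 1) * of_nat m * t)) (at w)" for w
    by (rule DERIV_cdivide) (auto intro!: derivative_eq_intros)
  moreover have "of_nat m * (t * w + \<gamma>) ^ (m - 1) * t / (\<gamma> ^ (m - 1) * of_nat m * t) = E (t * w)" for w
    using m \<gamma>0 False by (simp add: E_def power_divide)
  ultimately show ?thesis
    unfolding eq by (intro has_wirtinger_antiholomorphic) metis
qed

lemma wirtinger_\<Phi>:
  "has_wirtinger (\<Phi> t) (cnj z * S (t * cnj z) * poly (pderiv q) z - poly (pderiv p) z)
     (E (t * cnj z) * poly q z) z"
proof -
  have "has_wirtinger (\<lambda>z. cnj z * S (t * cnj z) * poly q z - poly p z)
      (0 * poly q z + cnj z * S (t * cnj z) * poly (pderiv q) z - poly (pderiv p) z)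
      (E (t * cnj z) * poly q z + cnj z * S (t * cnj z) * 0 - 0) z"
    by (intro has_wirtinger_diff has_wirtinger_mult wirtinger_cnj_S
        has_wirtinger_holomorphic poly_DERIV)
  then show ?thesis by (simp add: \<Phi>_def[abs_def])
qed

lemma continuous_\<Phi> [continuous_intros]:
  "continuous_on A g \<Longrightarrow> continuous_on A h \<Longrightarrow> continuous_on A (\<lambda>x. \<Phi> (g x) (h x))"
  unfolding \<Phi>_def by (intro continuous_intros)

lemma \<Phi>_tendsto: "((\<lambda>t. \<Phi> t z) \<longlongrightarrow> \<Phi> 0 z) (nhds 0)"
proof -
  have "continuous_on UNIV (\<lambda>t. \<Phi> t z)" by (intro continuous_intros)
  then have "isCont (\<lambda>t. \<Phi> t z) 0" by (simp add: continuous_on_eq_continuous_at)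
  then show ?thesis unfolding isCont_def by (rule iffD1[OF tendsto_at_iff_tendsto_nhds])
qed

section \<open>Local analysis near a bounded root and near infinity\<close>

lemma eventually_norm_mult_less:
  fixes C e :: real
  assumes "e > 0"
  shows "\<forall>\<^sub>F t in nhds (0::complex). norm t * C < e"
proof -
  have "continuous_on UNIV (\<lambda>t::complex. norm t * C)" by (intro continuous_intros)
  then have "isCont (\<lambda>t::complex. norm t * C) 0" by (simp add: continuous_on_eq_continuous_at)
  then have "((\<lambda>t::complex. norm t * C) \<longlongrightarrow> norm (0::complex) * C) (nhds 0)"
    unfolding isCont_def by (rule iffD1[OF tendsto_at_iff_tendsto_nhds])
  then show ?thesis by (rule order_tendstoD) (simp add: assms)
qed

text \<open>The contraction lemma is applied with the derivatives frozen at z = \<alpha>, t = 0. The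
  constant K depends neither on \<delta> nor on t, so the last clause will give convergence of the
  root although \<delta> stays fixed. Using \<open>nhds 0\<close> rather than \<open>at 0\<close>
  includes t = 0, which yields isolation of \<alpha>.\<close>

lemma near_root:
  assumes "simple_root (\<Phi> 0) \<alpha>"
  obtains K where "\<forall>\<^sub>F \<delta> in at_right 0. \<forall>\<^sub>F t in nhds 0.
    (\<exists>!z. z \<in> cball \<alpha> \<delta> \<and> \<Phi> t z = 0) \<and>
    (\<forall>z \<in> cball \<alpha> \<delta>. sgn (mixed_jacobian (\<Phi> t) z) = sgn (mixed_jacobian (\<Phi> 0) \<alpha>)) \<and>
    (\<forall>z \<in> cball \<alpha> \<delta>. \<Phi> t z = 0 \<longrightarrow> norm (z - \<alpha>) \<le> K * norm (\<Phi> t \<alpha>))"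
proof -
  \<comment> \<open>Treating U = \<open>t * cnj z\<close> as an independent variable turns smallness
    of t into joint continuity of \<open>a\<close> and \<open>b\<close> at (\<alpha>, 0).\<close>
  define a where "a z U = cnj z * S U * poly (pderiv q) z - poly (pderiv p) z" for z U
  define b where "b z U = E U * poly q z" for z U
  define \<kappa> where "\<kappa> = \<bar>norm (a \<alpha> 0) - norm (b \<alpha> 0)\<bar>"
  have der: "has_wirtinger (\<Phi> t) (a z (t * cnj z)) (b z (t * cnj z)) z" for t z
    using wirtinger_\<Phi>[of t z] by (simp add: a_def b_def)
  have J: "mixed_jacobian (\<Phi> 0) \<alpha> = (norm (a \<alpha> 0))\<^sup>2 - (norm (b \<alpha> 0))\<^sup>2"
    using mixed_jacobian_wirtinger[OF der, of 0 \<alpha>] by simp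
  have root: "\<Phi> 0 \<alpha> = 0" and "mixed_jacobian (\<Phi> 0) \<alpha> \<noteq> 0"
    using assms by (auto simp: simple_root_iff)
  then have \<kappa>: "\<kappa> > 0" by (auto simp: J \<kappa>_def)
  have close: "\<exists>\<eta>>0. \<forall>z U. norm (z - \<alpha>) < \<eta> \<longrightarrow> norm U < \<eta> \<longrightarrow> norm (g z U - g \<alpha> 0) \<le> \<kappa> / 4"
    if "continuous_on UNIV (\<lambda>x. g (fst x) (snd x))" for g :: "complex \<Rightarrow> complex \<Rightarrow> complex"
  proof -
    from that obtain d where d: "d > 0"
      "\<And>x. dist x (\<alpha>, 0) < d \<Longrightarrow> dist (g (fst x) (snd x)) (g \<alpha> 0) < \<kappa> / 4"
      unfolding continuous_on_iff using \<kappa> by (metis UNIV_I divide_pos_pos fst_conv snd_conv zero_less_numeral)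
    have "norm (g z U - g \<alpha> 0) \<le> \<kappa> / 4" if "norm (z - \<alpha>) < d / 2" "norm U < d / 2" for z U
    proof -
      have "dist (z, U) (\<alpha>, 0) < d"
        using that norm_Pair_le[of "z - \<alpha>" U] by (simp add: dist_norm)
      from d(2)[OF this] show ?thesis by (simp add: dist_norm)
    qed
    then show ?thesis using d(1) by (intro exI[of _ "d / 2"]) auto
  qed
  obtain \<eta>1 where \<eta>1: "\<eta>1 > 0" "\<And>z U. norm (z - \<alpha>) < \<eta>1 \<Longrightarrow> norm U < \<eta>1 \<Longrightarrow> norm (a z U - a \<alpha> 0) \<le> \<kappa> / 4"
    using close[of a] unfolding a_def by (force intro!: continuous_intros)
  obtain \<eta>2 where \<eta>2: "\<eta>2 > 0" "\<And>z U. norm (z - \<alpha>) < \<eta>2 \<Longrightarrow> norm U < \<eta>2 \<Longrightarrow> norm (b z U - b \<alpha> 0) \<le> \<kappa> / 4"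
    using close[of b] unfolding b_def by (force intro!: continuous_intros)
  define \<eta> where "\<eta> = min \<eta>1 \<eta>2"
  have "\<eta> > 0" using \<eta>1 \<eta>2 by (simp add: \<eta>_def)
  then have "\<forall>\<^sub>F \<delta> in at_right 0. \<delta> \<in> {0<..<\<eta>}"
    by (rule eventually_at_right_real)
  then have "\<forall>\<^sub>F \<delta> in at_right 0. \<forall>\<^sub>F t in nhds 0.
    (\<exists>!z. z \<in> cball \<alpha> \<delta> \<and> \<Phi> t z = 0) \<and>
    (\<forall>z \<in> cball \<alpha> \<delta>. sgn (mixed_jacobian (\<Phi> t) z) = sgn (mixed_jacobian (\<Phi> 0) \<alpha>)) \<and>
    (\<forall>z \<in> cball \<alpha> \<delta>. \<Phi> t z = 0 \<longrightarrow> norm (z - \<alpha>) \<le> 2 / \<kappa> * norm (\<Phi> t \<alpha>))"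
  proof eventually_elim
    case (elim \<delta>)
    then have \<delta>: "0 < \<delta>" "\<delta> < \<eta>" by auto
    have "\<forall>\<^sub>F t in nhds (0::complex). norm t * (norm \<alpha> + \<delta>) < \<eta>"
      using \<open>\<eta> > 0\<close> by (rule eventually_norm_mult_less)
    moreover have "((\<lambda>t. norm (\<Phi> t \<alpha>)) \<longlongrightarrow> 0) (nhds 0)"
      using tendsto_norm[OF \<Phi>_tendsto[of \<alpha>]] root by simp
    then have "\<forall>\<^sub>F t in nhds 0. norm (\<Phi> t \<alpha>) < \<kappa> * \<delta> / 4"
      using \<kappa> \<delta> by (intro order_tendstoD) auto
    ultimately show ?case
    proof eventually_elim
      case (elim t)
      have U: "norm (t * cnj z) < \<eta>" "norm (z - \<alpha>) < \<eta>" if "z \<in> cball \<alpha> \<delta>" for z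
      proof -
        have z: "norm (z - \<alpha>) \<le> \<delta>" using that by (simp add: dist_norm norm_minus_commute)
        then show "norm (z - \<alpha>) < \<eta>" using \<delta> by simp
        have "norm z \<le> norm \<alpha> + \<delta>" using z norm_triangle_sub[of z \<alpha>] by simp
        then have "norm t * norm z \<le> norm t * (norm \<alpha> + \<delta>)" by (intro mult_left_mono) auto
        then show "norm (t * cnj z) < \<eta>" using elim(1) by (simp add: norm_mult)
      qed
      have "norm (a z (t * cnj z) - a \<alpha> 0) \<le> \<kappa> / 4" "norm (b z (t * cnj z) - b \<alpha> 0) \<le> \<kappa> / 4"
        if "z \<in> cball \<alpha> \<delta>" for z
        using U[OF that] \<eta>1(2)[of z "t * cnj z"] \<eta>2(2)[of z "t * cnj z"] by (auto simp: \<eta>_def)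
      note uz = wirtinger_unique_zero[OF der \<kappa>_def \<kappa> this less_imp_le[OF \<delta>(1)] less_imp_le[OF elim(2)]]
      show ?case using uz unfolding J by blast
    qed
  qed
  then show ?thesis by (rule that)
qed

text \<open>Dividing by q turns the equation into \<open>cnj z * S (t * cnj z)\<close> = p/q. On the
  disc \<open>t * cnj z\<close> \<approx> V its derivatives are close to 0 in z and to
  \<open>E V\<close>, of modulus 1, in the conjugate. The disc has radius \<delta>/|t|, so the
  bounded value -p/q at its centre is small by comparison.\<close>

lemma far_root:
  assumes V: "(V + \<gamma>) ^ m = \<gamma> ^ m" "V \<noteq> 0"
  shows "\<forall>\<^sub>F \<delta> in at_right 0. \<forall>\<^sub>F t in at 0.
    (\<exists>!z. norm (t * cnj z - V) \<le> \<delta> \<and> \<Phi> t z = 0) \<and>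
    (\<forall>z. norm (t * cnj z - V) \<le> \<delta> \<longrightarrow> \<Phi> t z = 0 \<longrightarrow> mixed_jacobian (\<Phi> t) z < 0)"
proof -
  obtain R C C' where R: "R > 0" "C > 0" "C' > 0"
    "\<And>z. norm z \<ge> R \<Longrightarrow> poly q z \<noteq> 0"
    "\<And>z. norm z \<ge> R \<Longrightarrow> norm (poly p z / poly q z) \<le> C"
    "\<And>z. norm z \<ge> R \<Longrightarrow>
       norm ((poly (pderiv p) z * poly q z - poly p z * poly (pderiv q) z) / (poly q z)\<^sup>2) \<le> C' / norm z"
    by (rule rational_bounds[OF q0 deg_q deg_p]) blast
  define r where "r z = poly p z / poly q z" for z
  define r' where "r' z = (poly (pderiv p) z * poly q z - poly p z * poly (pderiv q) z) / (poly q z)\<^sup>2" for z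
  define \<psi> where "\<psi> t z = cnj z * S (t * cnj z) - r z" for t z
  have der: "has_wirtinger (\<psi> t) (- r' z) (E (t * cnj z)) z" if "norm z \<ge> R" for t z
  proof -
    have "(r has_field_derivative r' z) (at z)"
      unfolding r_def r'_def power2_eq_square
      by (intro DERIV_divide poly_DERIV R that)
    from has_wirtinger_diff[OF wirtinger_cnj_S has_wirtinger_holomorphic[OF this], of t]
    show ?thesis by (simp add: \<psi>_def[abs_def])
  qed
  \<comment> \<open>\<open>(V + \<gamma>) / \<gamma>\<close> is an m-th root of unity.\<close>
  have "norm ((V + \<gamma>) / \<gamma>) ^ m = 1"
    using V \<gamma>0 by (simp add: norm_divide power_divide flip: norm_power)
  then have "norm ((V + \<gamma>) / \<gamma>) = 1"
    using m power_eq_iff_eq_base[of m "norm ((V + \<gamma>) / \<gamma>)" 1] by simp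
  then have EV: "norm (E V) = 1" unfolding E_def norm_power by simp
  have SV: "S V = 0" using U_S[of V] V by simp
  have "continuous_on UNIV E" by (intro continuous_intros)
  then obtain \<eta> where \<eta>: "\<eta> > 0" "\<And>U. norm (U - V) < \<eta> \<Longrightarrow> norm (E U - E V) < 1 / 4"
    unfolding continuous_on_iff dist_norm by (metis UNIV_I zero_less_divide_1_iff zero_less_numeral)
  \<comment> \<open>The bound |V|/2 keeps |t z| at least |V|/2 on the disc, so that z is large when
    t is small.\<close>
  have "\<forall>\<^sub>F \<delta> in at_right 0. \<delta> \<in> {0<..<min \<eta> (norm V / 2)}"
    using \<eta> V by (intro eventually_at_right_real) auto
  then show ?thesis
  proof eventually_elim
    case (elim \<delta>)
    then have \<delta>: "0 < \<delta>" "\<delta> < \<eta>" "\<delta> < norm V / 2" by auto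
    have ev: "\<forall>\<^sub>F t in at (0::complex). norm t * M < e" if "e > 0" for M e
      using eventually_norm_mult_less[OF that] by (simp add: eventually_nhds_conv_at)
    have "\<forall>\<^sub>F t in at (0::complex). norm t * R < norm V / 2"
      "\<forall>\<^sub>F t in at (0::complex). norm t * (4 * C') < norm V / 2"
      "\<forall>\<^sub>F t in at (0::complex). norm t * (4 * C) < \<delta>" "\<forall>\<^sub>F t::complex in at 0. t \<noteq> 0"
      using V \<delta> by (intro ev; simp)+ (simp add: eventually_at_filter)
    then show ?case
    proof eventually_elim
      case (elim t)
      have t: "norm t > 0" using elim by simp
      define c where "c = cnj (V / t)"
      have tc: "t * cnj c = V" using elim by (simp add: c_def)
      have region: "z \<in> cball c (\<delta> / norm t) \<longleftrightarrow> norm (t * cnj z - V) \<le> \<delta>" for z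
      proof -
        have "norm (t * cnj z - V) = norm (t * cnj (z - c))" by (simp add: tc algebra_simps)
        also have "\<dots> = norm t * norm (z - c)" unfolding norm_mult by (simp del: complex_cnj_diff)
        finally show ?thesis using t by (simp add: dist_norm norm_minus_commute field_simps)
      qed
      have big: "norm z \<ge> R" "norm z \<ge> 4 * C'" if "norm (t * cnj z - V) \<le> \<delta>" for z
      proof -
        have "norm V / 2 \<le> norm t * norm z"
          using that \<delta> norm_triangle_ineq2[of V "t * cnj z"] by (simp add: norm_minus_commute norm_mult)
        then have "norm t * R \<le> norm t * norm z" "norm t * (4 * C') \<le> norm t * norm z"
          using elim by linarith+
        then show "norm z \<ge> R" "norm z \<ge> 4 * C'" using t by auto
      qed
      have r'_small: "norm (r' z) \<le> 1 / 4" if "norm (t * cnj z - V) \<le> \<delta>" for z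
      proof -
        have z: "norm z > 0" using big[OF that] R by linarith
        have "norm (r' z) \<le> C' / norm z" unfolding r'_def using big[OF that] R by blast
        also have "\<dots> \<le> 1 / 4" using big[OF that] z by (simp add: field_simps)
        finally show ?thesis .
      qed
      have cz: "norm c \<ge> R" using big[of c] \<delta> tc by simp
      have "norm (\<psi> t c) \<le> C" using R(5)[OF cz] by (simp add: \<psi>_def tc SV r_def)
      also have "\<dots> \<le> 1 * (\<delta> / norm t) / 4" using elim t by (simp add: field_simps)
      finally have \<psi>c: "norm (\<psi> t c) \<le> 1 * (\<delta> / norm t) / 4" .
      have "has_wirtinger (\<psi> t) (- r' z) (E (t * cnj z)) z"
        "norm (- r' z - 0) \<le> 1 / 4" "norm (E (t * cnj z) - E V) \<le> 1 / 4"
        if "z \<in> cball c (\<delta> / norm t)" for z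
        using der[of z t] big[of z] r'_small[of z] \<eta>(2)[of "t * cnj z"] \<delta> that
        unfolding region by auto
      note uz = wirtinger_unique_zero[OF this(1) _ _ this(2,3) _ \<psi>c]
      have \<Phi>\<psi>: "\<Phi> t z = poly q z * \<psi> t z" if "norm (t * cnj z - V) \<le> \<delta>" for z
        using R(4)[OF big(1)[OF that]] by (simp add: \<Phi>_def \<psi>_def r_def field_simps)
      have zero: "\<Phi> t z = 0 \<longleftrightarrow> \<psi> t z = 0" if "norm (t * cnj z - V) \<le> \<delta>" for z
        using R(4)[OF big(1)[OF that]] \<Phi>\<psi>[OF that] by simp
      show ?case
      proof (intro conjI allI impI)
        have "\<exists>!z. z \<in> cball c (\<delta> / norm t) \<and> \<psi> t z = 0"
          using uz(1) EV \<delta> t by simp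
        then show "\<exists>!z. norm (t * cnj z - V) \<le> \<delta> \<and> \<Phi> t z = 0"
          unfolding region using zero by metis
        fix z assume z: "norm (t * cnj z - V) \<le> \<delta>" "\<Phi> t z = 0"
        have q: "poly q z \<noteq> 0" using R(4) big[OF z(1)] by blast
        \<comment> \<open>At a root, \<open>cnj z * S (t * cnj z)\<close> may be replaced by p/q;
          the z-derivative of \<open>\<Phi> t\<close> then becomes -q (p/q)', so the Jacobian is
          |q|^2 times that of \<open>\<psi> t\<close>.\<close>
        have S: "cnj z * S (t * cnj z) = r z" using z zero \<psi>_def by auto
        have \<Phi>_z: "cnj z * S (t * cnj z) * poly (pderiv q) z - poly (pderiv p) z = - (poly q z * r' z)"
          unfolding S r_def r'_def using q by (simp add: field_simps power2_eq_square)
        have J: "mixed_jacobian (\<Phi> t) z = (norm (poly q z))\<^sup>2 * ((norm (r' z))\<^sup>2 - (norm (E (t * cnj z)))\<^sup>2)"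
          unfolding mixed_jacobian_wirtinger[OF wirtinger_\<Phi>] \<Phi>_z
          by (simp add: norm_mult power_mult_distrib right_diff_distrib mult.commute)
        have "norm (E (t * cnj z) - E V) < 1 / 4" using \<eta>(2)[of "t * cnj z"] z \<delta> by simp
        then have "norm (E (t * cnj z)) > 1 / 4"
          using EV norm_triangle_ineq2[of "E V" "E (t * cnj z)"] by (simp add: norm_minus_commute)
        then have "norm (r' z) < norm (E (t * cnj z))" using r'_small[OF z(1)] by linarith
        then have "(norm (r' z))\<^sup>2 < (norm (E (t * cnj z)))\<^sup>2" by (intro power_strict_mono) auto
        then show "mixed_jacobian (\<Phi> t) z < 0" unfolding J using q by (simp add: mult_pos_neg)
      qed
    qed
  qed
qed

section \<open>Finiteness of the roots of the lens polynomial\<close>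

lemma roots_bounded:
  obtains R where "\<And>z. \<Phi> 0 z = 0 \<Longrightarrow> norm z < R"
proof -
  obtain R C C' where R: "R > 0" "C > 0" "C' > 0"
    "\<And>z. norm z \<ge> R \<Longrightarrow> poly q z \<noteq> 0"
    "\<And>z. norm z \<ge> R \<Longrightarrow> norm (poly p z / poly q z) \<le> C"
    "\<And>z. norm z \<ge> R \<Longrightarrow>
       norm ((poly (pderiv p) z * poly q z - poly p z * poly (pderiv q) z) / (poly q z)\<^sup>2) \<le> C' / norm z"
    by (rule rational_bounds[OF q0 deg_q deg_p]) blast
  have "norm z < max R (C + 1)" if z: "\<Phi> 0 z = 0" for z
  proof (rule ccontr)
    assume "\<not> norm z < max R (C + 1)"
    then have big: "norm z \<ge> R" "norm z \<ge> C + 1" by auto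
    have "cnj z = poly p z / poly q z"
      using z R(4)[OF big(1)] by (simp add: \<Phi>_def S_0 field_simps)
    then have "norm z \<le> C" using R(5)[OF big(1)] by (metis complex_mod_cnj)
    then show False using big by simp
  qed
  then show ?thesis by (rule that)
qed

lemma closed_roots: "closed (mixed_roots (\<Phi> 0))"
  unfolding mixed_roots_def by (intro closed_Collect_eq continuous_intros)

text \<open>The root set is compact, and by \<open>near_root\<close> at t = 0 each of its points is
  isolated.\<close>

lemma finite_roots:
  assumes "all_roots_simple (\<Phi> 0)"
  shows "finite (mixed_roots (\<Phi> 0))"
proof -
  obtain R where R: "\<And>z. \<Phi> 0 z = 0 \<Longrightarrow> norm z < R" by (rule roots_bounded) blast
  then have "bounded (mixed_roots (\<Phi> 0))"
    by (intro boundedI[of _ R]) (auto simp: mixed_roots_def less_imp_le)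
  then have "compact (mixed_roots (\<Phi> 0))"
    using closed_roots compact_eq_bounded_closed by blast
  moreover have "\<not> \<alpha> islimpt mixed_roots (\<Phi> 0)" if \<alpha>: "\<alpha> \<in> mixed_roots (\<Phi> 0)" for \<alpha>
  proof -
    have "simple_root (\<Phi> 0) \<alpha>" using assms \<alpha> by (simp add: all_roots_simple_def)
    then obtain K where "\<forall>\<^sub>F \<delta> in at_right 0. \<forall>\<^sub>F t in nhds 0.
      (\<exists>!z. z \<in> cball \<alpha> \<delta> \<and> \<Phi> t z = 0) \<and>
      (\<forall>z \<in> cball \<alpha> \<delta>. sgn (mixed_jacobian (\<Phi> t) z) = sgn (mixed_jacobian (\<Phi> 0) \<alpha>)) \<and>
      (\<forall>z \<in> cball \<alpha> \<delta>. \<Phi> t z = 0 \<longrightarrow> norm (z - \<alpha>) \<le> K * norm (\<Phi> t \<alpha>))"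
      by (rule near_root)
    moreover have "\<forall>\<^sub>F \<delta>::real in at_right 0. \<delta> > 0" by (rule eventually_at_right_less)
    \<comment> \<open>An event that holds eventually in \<open>nhds 0\<close> holds at t = 0
      itself.\<close>
    ultimately have "\<forall>\<^sub>F \<delta> in at_right 0. \<delta> > 0 \<and> (\<exists>!z. z \<in> cball \<alpha> \<delta> \<and> \<Phi> 0 z = 0)"
      by eventually_elim (use eventually_nhds_x_imp_x in blast)
    then obtain \<delta> where \<delta>: "\<delta> > 0" "\<exists>!z. z \<in> cball \<alpha> \<delta> \<and> \<Phi> 0 z = 0"
      using eventually_happens'[OF trivial_limit_at_right_real] by blast
    have "\<alpha> \<in> cball \<alpha> \<delta>" "\<Phi> 0 \<alpha> = 0" using \<alpha> \<delta>(1) by (auto simp: mixed_roots_def)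
    then have "z = \<alpha>" if "z \<in> cball \<alpha> \<delta>" "\<Phi> 0 z = 0" for z
      using \<delta>(2) that by blast
    then show ?thesis
      unfolding islimpt_approachable using \<delta>(1)
      by (auto simp: mixed_roots_def dist_commute intro!: exI[of _ \<delta>])
  qed
  ultimately have "finite (mixed_roots (\<Phi> 0) \<inter> mixed_roots (\<Phi> 0))"
    by (intro finite_not_islimpt_in_compact)
  then show ?thesis by simp
qed

text \<open>Equivalently the zeros of \<open>S\<close>, since \<open>S 0 = 1\<close>. The removed
  solution V = 0 belongs to the roots that stay bounded.\<close>

definition far_centers :: "complex set" where
  "far_centers = {V. (V + \<gamma>) ^ m = \<gamma> ^ m} - {0}"

lemma finite_far_centers: "finite far_centers" and card_far_centers: "card far_centers = m - 1"
proof -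
  have "V \<in> (\<lambda>w. w - \<gamma>) ` ({w. w ^ m = \<gamma> ^ m} - {\<gamma>})" if "V \<in> far_centers" for V
    using that by (intro image_eqI[of _ _ "V + \<gamma>"]) (auto simp: far_centers_def)
  then have eq: "far_centers = (\<lambda>w. w - \<gamma>) ` ({w. w ^ m = \<gamma> ^ m} - {\<gamma>})"
    by (auto simp: far_centers_def)
  have card: "card {w. w ^ m = \<gamma> ^ m} = m" using m \<gamma>0 by (intro card_nth_roots) auto
  then have fin: "finite {w. w ^ m = \<gamma> ^ m}" using m by (intro card_ge_0_finite) auto
  show "finite far_centers" unfolding eq using fin by simp
  show "card far_centers = m - 1"
    unfolding eq using card fin by (subst card_image) (auto simp: inj_on_def)
qed

text \<open>An approximate solution lies near an exact one: U is confined to a fixed ball, and off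
  the \<delta>-balls around the solutions the continuous function has a positive minimum
  there.\<close>

lemma zeros_of_power_approx:
  assumes "\<delta> > 0"
  shows "\<exists>\<mu>>0. \<forall>U. norm ((U + \<gamma>) ^ m - \<gamma> ^ m) < \<mu> \<longrightarrow>
    (\<exists>V. (V + \<gamma>) ^ m = \<gamma> ^ m \<and> norm (U - V) < \<delta>)"
proof -
  \<comment> \<open>If the defect is below 1 then \<open>norm (U + \<gamma>) ^ m \<le> M\<close>, so
    \<open>norm (U + \<gamma>)\<close> is at most 1 or at most M; hence the radius 1 + M.\<close>
  define M where "M = norm \<gamma> ^ m + 1"
  define K where "K = cball (- \<gamma>) (1 + M) - (\<Union>V\<in>{V. (V + \<gamma>) ^ m = \<gamma> ^ m}. ball V \<delta>)"
  have "compact K" unfolding K_def by (intro compact_diff compact_cball open_UN) auto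
  moreover have "continuous_on K (\<lambda>U. (U + \<gamma>) ^ m - \<gamma> ^ m)" by (intro continuous_intros)
  moreover have "(U + \<gamma>) ^ m - \<gamma> ^ m \<noteq> 0" if "U \<in> K" for U
    using that assms by (auto simp: K_def)
  ultimately have "\<exists>\<mu>>0. \<forall>U\<in>K. norm ((U + \<gamma>) ^ m - \<gamma> ^ m) \<ge> \<mu>"
    by (rule continuous_nonzero_lower_bound)
  then obtain \<mu> where \<mu>: "\<mu> > 0" "\<And>U. U \<in> K \<Longrightarrow> norm ((U + \<gamma>) ^ m - \<gamma> ^ m) \<ge> \<mu>"
    by blast
  have "\<exists>V. (V + \<gamma>) ^ m = \<gamma> ^ m \<and> norm (U - V) < \<delta>"
    if U: "norm ((U + \<gamma>) ^ m - \<gamma> ^ m) < min 1 \<mu>" for U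
  proof -
    have "norm (U + \<gamma>) ^ m \<le> norm (\<gamma> ^ m) + norm ((U + \<gamma>) ^ m - \<gamma> ^ m)"
      unfolding norm_power[symmetric] by (rule norm_triangle_sub)
    then have pow: "norm (U + \<gamma>) ^ m \<le> M" using U by (simp add: M_def norm_power)
    have "norm (U + \<gamma>) \<le> 1 + M"
    proof (cases "norm (U + \<gamma>) \<le> 1")
      case False
      then have "norm (U + \<gamma>) \<le> norm (U + \<gamma>) ^ m" using m by (intro self_le_power) auto
      then show ?thesis using pow by simp
    next
      case True
      moreover have "norm \<gamma> ^ m \<ge> 0" by simp
      ultimately show ?thesis unfolding M_def by linarith
    qed
    then have "U \<in> cball (- \<gamma>) (1 + M)" by (simp add: dist_norm norm_minus_commute add.commute)
    moreover have "U \<notin> K" using \<mu>(2)[of U] U by auto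
    ultimately show ?thesis by (auto simp: K_def dist_norm norm_minus_commute)
  qed
  then show ?thesis using \<mu>(1) by (intro exI[of _ "min 1 \<mu>"]) auto
qed

text \<open>The plane is cut at a fixed radius R. Inside, \<open>\<Phi> t\<close> is uniformly close
  to \<open>\<Phi> 0\<close>, which is bounded below off the \<delta>-balls around its roots.
  Outside, \<open>U * S U\<close> = t p/q is small, which puts U near a solution V.\<close>

lemma roots_cover:
  "\<forall>\<^sub>F \<delta> in at_right 0. \<forall>\<^sub>F t in at 0. \<forall>z. \<Phi> t z = 0 \<longrightarrow>
     (\<exists>\<alpha> \<in> mixed_roots (\<Phi> 0). z \<in> cball \<alpha> \<delta>) \<or> (\<exists>V \<in> far_centers. norm (t * cnj z - V) \<le> \<delta>)"
proof -
  have "continuous_on UNIV S" by (intro continuous_intros continuous_on_id)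
  then have S_near: "\<exists>\<eta>>0. \<forall>U. norm U < \<eta> \<longrightarrow> norm (S U - 1) < e" if "e > 0" for e
    unfolding continuous_on_iff dist_norm using S_0 that by (metis UNIV_I diff_zero)
  obtain R0 C C' where R0: "R0 > 0" "C > 0" "C' > 0"
    "\<And>z. norm z \<ge> R0 \<Longrightarrow> poly q z \<noteq> 0"
    "\<And>z. norm z \<ge> R0 \<Longrightarrow> norm (poly p z / poly q z) \<le> C"
    "\<And>z. norm z \<ge> R0 \<Longrightarrow>
       norm ((poly (pderiv p) z * poly q z - poly p z * poly (pderiv q) z) / (poly q z)\<^sup>2) \<le> C' / norm z"
    by (rule rational_bounds[OF q0 deg_q deg_p]) blast
  \<comment> \<open>R exceeds 2 C so that a root outside R with |S| \<ge> 1/2 would contradict |z S|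
    = |p/q| \<le> C; this rules out V = 0.\<close>
  define R where "R = max R0 (2 * C + 1)"
  have R: "R > 0" "R > 2 * C" "R \<ge> R0" using R0 by (auto simp: R_def)
  obtain \<eta> where \<eta>: "\<eta> > 0" "\<And>U. norm U < \<eta> \<Longrightarrow> norm (S U - 1) < 1 / 2"
    using S_near[of "1/2"] by auto
  have "\<forall>\<^sub>F \<delta> in at_right 0. \<delta> \<in> {0<..<\<eta>}"
    using \<eta> by (intro eventually_at_right_real)
  then show ?thesis
  proof eventually_elim
    case (elim \<delta>)
    then have \<delta>: "0 < \<delta>" "\<delta> < \<eta>" by auto
    define K where "K = cball 0 R - (\<Union>\<alpha>\<in>mixed_roots (\<Phi> 0). ball \<alpha> \<delta>)"
    have "compact K" unfolding K_def by (intro compact_diff compact_cball open_UN) auto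
    moreover have "continuous_on K (\<Phi> 0)" by (intro continuous_intros)
    moreover have "\<Phi> 0 z \<noteq> 0" if "z \<in> K" for z
      using that \<delta> by (auto simp: K_def mixed_roots_def)
    ultimately have "\<exists>\<mu>>0. \<forall>z\<in>K. norm (\<Phi> 0 z) \<ge> \<mu>"
      by (rule continuous_nonzero_lower_bound)
    then obtain \<mu> where \<mu>: "\<mu> > 0" "\<And>z. z \<in> K \<Longrightarrow> norm (\<Phi> 0 z) \<ge> \<mu>"
      by blast
    have "compact ((\<lambda>z. cnj z * poly q z) ` cball 0 R)"
      by (intro compact_continuous_image continuous_intros) auto
    then have "bounded ((\<lambda>z. cnj z * poly q z) ` cball 0 R)" by (rule compact_imp_bounded)
    then obtain B where B: "B > 0" "\<And>z. norm z \<le> R \<Longrightarrow> norm (cnj z * poly q z) \<le> B"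
      unfolding bounded_pos by auto
    obtain \<eta>' where \<eta>': "\<eta>' > 0" "\<And>U. norm U < \<eta>' \<Longrightarrow> norm (S U - 1) < \<mu> / B"
      using S_near[of "\<mu> / B"] \<mu> B by auto
    obtain \<mu>' where \<mu>': "\<mu>' > 0"
      "\<And>U. norm ((U + \<gamma>) ^ m - \<gamma> ^ m) < \<mu>' \<Longrightarrow> \<exists>V. (V + \<gamma>) ^ m = \<gamma> ^ m \<and> norm (U - V) < \<delta>"
      using zeros_of_power_approx[OF \<delta>(1)] by metis
    define c where "c = norm (\<gamma> ^ (m - 1) * of_nat m)"
    have "\<forall>\<^sub>F t in at (0::complex). norm t * R < \<eta>'" "\<forall>\<^sub>F t in at (0::complex). norm t * (c * C) < \<mu>'"
      "\<forall>\<^sub>F t::complex in at 0. t \<noteq> 0"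
      using eventually_norm_mult_less[OF \<eta>'(1), of R] eventually_norm_mult_less[OF \<mu>'(1), of "c * C"]
      by (simp_all add: eventually_nhds_conv_at eventually_neq_at_within)
    then show ?case
    proof eventually_elim
      case (elim t)
      show ?case
      proof (intro allI impI)
        fix z assume z: "\<Phi> t z = 0"
        show "(\<exists>\<alpha> \<in> mixed_roots (\<Phi> 0). z \<in> cball \<alpha> \<delta>) \<or> (\<exists>V \<in> far_centers. norm (t * cnj z - V) \<le> \<delta>)"
        proof (cases "norm z \<le> R")
          case True
          have "norm t * norm z \<le> norm t * R" using True by (intro mult_left_mono) auto
          then have "norm (t * cnj z) < \<eta>'" using elim(1) by (simp add: norm_mult)
          then have "norm (S (t * cnj z) - 1) < \<mu> / B" by (rule \<eta>')
          then have "norm (S (t * cnj z) - 1) * B < \<mu>" using B by (simp add: field_simps)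
          moreover have "norm (\<Phi> 0 z) = norm (\<Phi> t z - \<Phi> 0 z)" using z by simp
          moreover have "\<Phi> t z - \<Phi> 0 z = (S (t * cnj z) - 1) * (cnj z * poly q z)"
            by (simp add: \<Phi>_def S_0 algebra_simps)
          moreover have "norm ((S (t * cnj z) - 1) * (cnj z * poly q z)) \<le> norm (S (t * cnj z) - 1) * B"
            unfolding norm_mult[of "S (t * cnj z) - 1"] using B(2)[OF True] by (intro mult_left_mono) auto
          ultimately have "norm (\<Phi> 0 z) < \<mu>" by simp
          then have "z \<notin> K" using \<mu>(2)[of z] by auto
          then show ?thesis using True by (force simp: K_def)
        next
          case False
          then have big: "norm z \<ge> R0" using R by simp
          have eq: "cnj z * S (t * cnj z) = poly p z / poly q z"
            using z R0(4)[OF big] by (simp add: \<Phi>_def field_simps)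
          have "(t * cnj z) * S (t * cnj z) = t * (poly p z / poly q z)"
            using eq by (simp add: mult.assoc)
          then have "((t * cnj z + \<gamma>) ^ m - \<gamma> ^ m)
              = (\<gamma> ^ (m - 1) * of_nat m) * (t * (poly p z / poly q z))"
            using m \<gamma>0 unfolding U_S by (simp add: field_simps)
          then have "norm ((t * cnj z + \<gamma>) ^ m - \<gamma> ^ m) = c * (norm t * norm (poly p z / poly q z))"
            by (simp only: norm_mult c_def)
          also have "\<dots> \<le> c * (norm t * C)"
            using R0(5)[OF big] by (intro mult_left_mono) (auto simp: c_def)
          also have "\<dots> < \<mu>'" using elim by (simp add: mult_ac)
          finally obtain V where V: "(V + \<gamma>) ^ m = \<gamma> ^ m" "norm (t * cnj z - V) < \<delta>"
            using \<mu>' by blast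
          have "V \<noteq> 0"
          proof
            assume "V = 0"
            then have "norm (S (t * cnj z) - 1) < 1 / 2" using V \<delta> by (intro \<eta>) simp
            then have "norm (S (t * cnj z)) \<ge> 1 / 2"
              using norm_triangle_ineq2[of 1 "S (t * cnj z)"] by (simp add: norm_minus_commute)
            then have "norm z * (1 / 2) \<le> norm z * norm (S (t * cnj z))"
              by (intro mult_left_mono) auto
            also have "\<dots> = norm (cnj z * S (t * cnj z))" by (simp add: norm_mult)
            also have "\<dots> \<le> C" unfolding eq using R0(5)[OF big] .
            finally show False using False R by simp
          qed
          then show ?thesis using V by (auto simp: far_centers_def intro!: less_imp_le)
        qed
      qed
    qed
  qed
qed

text \<open>The sum type lets one family index both kinds of root: \<open>Inl\<close> for bounded
  roots, \<open>Inr\<close> for escaping ones, whose discs are measured in the coordinate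
  \<open>t * cnj z\<close>.\<close>

definition region :: "real \<Rightarrow> complex \<Rightarrow> complex + complex \<Rightarrow> complex set" where
  "region \<delta> t i = (case i of Inl \<alpha> \<Rightarrow> cball \<alpha> \<delta> | Inr V \<Rightarrow> {z. norm (t * cnj z - V) \<le> \<delta>})"

lemma region_simps [simp]:
  "region \<delta> t (Inl \<alpha>) = cball \<alpha> \<delta>"
  "region \<delta> t (Inr V) = {z. norm (t * cnj z - V) \<le> \<delta>}"
  by (simp_all add: region_def)

text \<open>On a fixed ball t z tends to 0, whereas in the far region |t z| exceeds |V|/2.\<close>

lemma near_far_disjoint:
  assumes "V \<noteq> 0"
  shows "\<forall>\<^sub>F \<delta> in at_right 0. \<forall>\<^sub>F t in at 0. region \<delta> t (Inl \<alpha>) \<inter> region \<delta> t (Inr V) = {}"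
proof -
  have "\<forall>\<^sub>F \<delta> in at_right 0. \<delta> \<in> {0<..<norm V / 2}"
    using assms by (intro eventually_at_right_real) auto
  then show ?thesis
  proof eventually_elim
    case (elim \<delta>)
    have "\<forall>\<^sub>F t in nhds (0::complex). norm t * (norm \<alpha> + \<delta>) < norm V / 2"
      using assms by (intro eventually_norm_mult_less) auto
    then have "\<forall>\<^sub>F t in at (0::complex). norm t * (norm \<alpha> + \<delta>) < norm V / 2"
      by (simp add: eventually_nhds_conv_at)
    then show ?case
    proof eventually_elim
      case (elim t)
      have False if z: "z \<in> cball \<alpha> \<delta>" "norm (t * cnj z - V) \<le> \<delta>" for z
      proof -
        have "norm z \<le> norm \<alpha> + \<delta>"
          using z(1) norm_triangle_sub[of z \<alpha>] by (simp add: dist_norm norm_minus_commute)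
        then have "norm t * norm z \<le> norm t * (norm \<alpha> + \<delta>)" by (intro mult_left_mono) auto
        moreover have "norm V \<le> \<delta> + norm t * norm z"
          using z(2) norm_triangle_sub[of V "t * cnj z"] by (simp add: norm_minus_commute norm_mult)
        ultimately show False using elim \<open>\<delta> \<in> {0<..<norm V / 2}\<close> by simp
      qed
      then show ?case by auto
    qed
  qed
qed

lemma regions_disjoint:
  assumes "i \<noteq> j" "i \<in> UNIV <+> (- {0})" "j \<in> UNIV <+> (- {0})"
  shows "\<forall>\<^sub>F \<delta> in at_right 0. \<forall>\<^sub>F t in at 0. region \<delta> t i \<inter> region \<delta> t j = {}"
proof -
  have half: "\<forall>\<^sub>F \<delta> in at_right 0. \<delta> \<in> {0<..<dist x y / 2}" if "x \<noteq> y" for x y :: complex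
    using that by (intro eventually_at_right_real) auto
  show ?thesis
  proof (cases i; cases j)
    fix a b assume ij: "i = Inl a" "j = Inl b"
    have "a \<noteq> b" using ij assms(1) by simp
    from half[OF this] show ?thesis unfolding ij region_simps
    proof (eventually_elim, intro always_eventually allI)
      fix \<delta> assume "\<delta> \<in> {0<..<dist a b / 2}"
      then show "cball a \<delta> \<inter> cball b \<delta> = {}"
        using disjoint_cballI[of \<delta> \<delta> a b] by simp
    qed
  next
    fix a b assume ij: "i = Inr a" "j = Inr b"
    have "a \<noteq> b" using ij assms(1) by simp
    from half[OF this] show ?thesis unfolding ij region_simps
    proof (eventually_elim, intro always_eventually allI equals0I)
      fix \<delta> t z
      assume "\<delta> \<in> {0<..<dist a b / 2}"
        "z \<in> {z. norm (t * cnj z - a) \<le> \<delta>} \<inter> {z. norm (t * cnj z - b) \<le> \<delta>}"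
      then show False
        using dist_triangle[of a b "t * cnj z"] by (simp add: dist_norm norm_minus_commute)
    qed
  next
    fix a b assume ij: "i = Inl a" "j = Inr b"
    then show ?thesis using near_far_disjoint[of b a] assms by auto
  next
    fix a b assume ij: "i = Inr a" "j = Inl b"
    then show ?thesis using near_far_disjoint[of a b] assms by (auto simp: Int_commute)
  qed
qed

text \<open>One \<delta> is fixed for all regions, then t0. The roots are indexed by the old roots
  and the far centres themselves, so no enumeration has to be chosen yet.\<close>

lemma roots_of_deformation:
  assumes simple: "all_roots_simple (\<Phi> 0)"
  obtains r :: "complex + complex \<Rightarrow> complex \<Rightarrow> complex" and t0 :: real where "t0 > 0"
    "\<And>t. 0 < norm t \<Longrightarrow> norm t < t0 \<Longrightarrow>
       bij_betw (\<lambda>i. r i t) (mixed_roots (\<Phi> 0) <+> far_centers) (mixed_roots (\<Phi> t))"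
    "\<And>\<alpha>. \<alpha> \<in> mixed_roots (\<Phi> 0) \<Longrightarrow> (r (Inl \<alpha>) \<longlongrightarrow> \<alpha>) (at 0)"
    "\<And>\<alpha> t. \<alpha> \<in> mixed_roots (\<Phi> 0) \<Longrightarrow> 0 < norm t \<Longrightarrow> norm t < t0 \<Longrightarrow>
       sgn (mixed_jacobian (\<Phi> t) (r (Inl \<alpha>) t)) = sgn (mixed_jacobian (\<Phi> 0) \<alpha>)"
    "\<And>V. V \<in> far_centers \<Longrightarrow> filterlim (r (Inr V)) at_infinity (at 0)"
    "\<And>V t. V \<in> far_centers \<Longrightarrow> 0 < norm t \<Longrightarrow> norm t < t0 \<Longrightarrow>
       mixed_jacobian (\<Phi> t) (r (Inr V) t) < 0"
proof -
  define Z where "Z = mixed_roots (\<Phi> 0)"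
  define I where "I = Z <+> far_centers"
  have finZ: "finite Z" unfolding Z_def using simple by (rule finite_roots)
  have finI: "finite I" using finZ finite_far_centers by (simp add: I_def)
  have "\<forall>\<alpha>\<in>Z. \<exists>K. \<forall>\<^sub>F \<delta> in at_right 0. \<forall>\<^sub>F t in nhds 0.
    (\<exists>!z. z \<in> cball \<alpha> \<delta> \<and> \<Phi> t z = 0) \<and>
    (\<forall>z \<in> cball \<alpha> \<delta>. sgn (mixed_jacobian (\<Phi> t) z) = sgn (mixed_jacobian (\<Phi> 0) \<alpha>)) \<and>
    (\<forall>z \<in> cball \<alpha> \<delta>. \<Phi> t z = 0 \<longrightarrow> norm (z - \<alpha>) \<le> K * norm (\<Phi> t \<alpha>))"
  proof
    fix \<alpha> assume "\<alpha> \<in> Z"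
    then have "simple_root (\<Phi> 0) \<alpha>" using simple by (simp add: all_roots_simple_def Z_def)
    then show "\<exists>K. \<forall>\<^sub>F \<delta> in at_right 0. \<forall>\<^sub>F t in nhds 0.
      (\<exists>!z. z \<in> cball \<alpha> \<delta> \<and> \<Phi> t z = 0) \<and>
      (\<forall>z \<in> cball \<alpha> \<delta>. sgn (mixed_jacobian (\<Phi> t) z) = sgn (mixed_jacobian (\<Phi> 0) \<alpha>)) \<and>
      (\<forall>z \<in> cball \<alpha> \<delta>. \<Phi> t z = 0 \<longrightarrow> norm (z - \<alpha>) \<le> K * norm (\<Phi> t \<alpha>))"
      by (rule near_root) (rule exI)
  qed
  then obtain K where K: "\<And>\<alpha>. \<alpha> \<in> Z \<Longrightarrow> \<forall>\<^sub>F \<delta> in at_right 0. \<forall>\<^sub>F t in nhds 0.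
    (\<exists>!z. z \<in> cball \<alpha> \<delta> \<and> \<Phi> t z = 0) \<and>
    (\<forall>z \<in> cball \<alpha> \<delta>. sgn (mixed_jacobian (\<Phi> t) z) = sgn (mixed_jacobian (\<Phi> 0) \<alpha>)) \<and>
    (\<forall>z \<in> cball \<alpha> \<delta>. \<Phi> t z = 0 \<longrightarrow> norm (z - \<alpha>) \<le> K \<alpha> * norm (\<Phi> t \<alpha>))"
    unfolding bchoice_iff by blast
  define good where "good \<delta> t \<longleftrightarrow>
      (\<forall>i\<in>I. \<exists>!z. z \<in> region \<delta> t i \<and> z \<in> mixed_roots (\<Phi> t)) \<and>
      (\<forall>\<alpha>\<in>Z. \<forall>z \<in> cball \<alpha> \<delta>. sgn (mixed_jacobian (\<Phi> t) z) = sgn (mixed_jacobian (\<Phi> 0) \<alpha>)) \<and>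
      (\<forall>\<alpha>\<in>Z. \<forall>z \<in> cball \<alpha> \<delta>. \<Phi> t z = 0 \<longrightarrow> norm (z - \<alpha>) \<le> K \<alpha> * norm (\<Phi> t \<alpha>)) \<and>
      (\<forall>V\<in>far_centers. \<forall>z. norm (t * cnj z - V) \<le> \<delta> \<longrightarrow> \<Phi> t z = 0 \<longrightarrow> mixed_jacobian (\<Phi> t) z < 0) \<and>
      mixed_roots (\<Phi> t) \<subseteq> (\<Union>i\<in>I. region \<delta> t i) \<and>
      (\<forall>i\<in>I. \<forall>j\<in>I. i \<noteq> j \<longrightarrow> region \<delta> t i \<inter> region \<delta> t j = {})" for \<delta> t
  have goodD:
    "good \<delta> t \<Longrightarrow> \<forall>i\<in>I. \<exists>!z. z \<in> region \<delta> t i \<and> z \<in> mixed_roots (\<Phi> t)"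
    "good \<delta> t \<Longrightarrow> \<forall>\<alpha>\<in>Z. \<forall>z \<in> cball \<alpha> \<delta>. sgn (mixed_jacobian (\<Phi> t) z) = sgn (mixed_jacobian (\<Phi> 0) \<alpha>)"
    "good \<delta> t \<Longrightarrow> \<forall>\<alpha>\<in>Z. \<forall>z \<in> cball \<alpha> \<delta>. \<Phi> t z = 0 \<longrightarrow> norm (z - \<alpha>) \<le> K \<alpha> * norm (\<Phi> t \<alpha>)"
    "good \<delta> t \<Longrightarrow> \<forall>V\<in>far_centers. \<forall>z. norm (t * cnj z - V) \<le> \<delta> \<longrightarrow> \<Phi> t z = 0 \<longrightarrow> mixed_jacobian (\<Phi> t) z < 0"
    "good \<delta> t \<Longrightarrow> mixed_roots (\<Phi> t) \<subseteq> (\<Union>i\<in>I. region \<delta> t i)"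
    "good \<delta> t \<Longrightarrow> \<forall>i\<in>I. \<forall>j\<in>I. i \<noteq> j \<longrightarrow> region \<delta> t i \<inter> region \<delta> t j = {}" for \<delta> t
    unfolding good_def by (elim conjE; assumption)+
  have ev_near: "\<forall>\<^sub>F \<delta> in at_right 0. \<forall>\<^sub>F t in at 0. \<forall>\<alpha>\<in>Z.
    (\<exists>!z. z \<in> cball \<alpha> \<delta> \<and> \<Phi> t z = 0) \<and>
    (\<forall>z \<in> cball \<alpha> \<delta>. sgn (mixed_jacobian (\<Phi> t) z) = sgn (mixed_jacobian (\<Phi> 0) \<alpha>)) \<and>
    (\<forall>z \<in> cball \<alpha> \<delta>. \<Phi> t z = 0 \<longrightarrow> norm (z - \<alpha>) \<le> K \<alpha> * norm (\<Phi> t \<alpha>))"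
    by (rule eventually_eventually_ball_finite[OF finZ])
      (erule eventually_mono[OF K], unfold eventually_nhds_conv_at, erule conjunct1)
  have ev_far: "\<forall>\<^sub>F \<delta> in at_right 0. \<forall>\<^sub>F t in at 0. \<forall>V\<in>far_centers.
    (\<exists>!z. norm (t * cnj z - V) \<le> \<delta> \<and> \<Phi> t z = 0) \<and>
    (\<forall>z. norm (t * cnj z - V) \<le> \<delta> \<longrightarrow> \<Phi> t z = 0 \<longrightarrow> mixed_jacobian (\<Phi> t) z < 0)"
    by (rule eventually_eventually_ball_finite[OF finite_far_centers])
      (rule far_root; simp add: far_centers_def)
  have ev_disj: "\<forall>\<^sub>F \<delta> in at_right 0. \<forall>\<^sub>F t in at 0. \<forall>i\<in>I. \<forall>j\<in>I. i \<noteq> j \<longrightarrow>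
    region \<delta> t i \<inter> region \<delta> t j = {}"
  proof (intro eventually_eventually_ball_finite[OF finI])
    fix i j assume "i \<in> I" "j \<in> I"
    then have "i \<in> UNIV <+> (- {0})" "j \<in> UNIV <+> (- {0})"
      by (auto simp: I_def far_centers_def)
    then show "\<forall>\<^sub>F \<delta> in at_right 0. \<forall>\<^sub>F t in at 0. i \<noteq> j \<longrightarrow> region \<delta> t i \<inter> region \<delta> t j = {}"
      using regions_disjoint[of i j] by (cases "i = j") auto
  qed
  have "\<forall>\<^sub>F \<delta> in at_right 0. \<forall>\<^sub>F t in at 0. good \<delta> t"
    using ev_near ev_far ev_disj roots_cover
  proof eventually_elim
    case (elim \<delta>)
    then show ?case
    proof eventually_elim
      case (elim t)
      have "\<forall>i\<in>I. \<exists>!z. z \<in> region \<delta> t i \<and> z \<in> mixed_roots (\<Phi> t)"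
      proof
        fix i assume "i \<in> I"
        then show "\<exists>!z. z \<in> region \<delta> t i \<and> z \<in> mixed_roots (\<Phi> t)"
          unfolding I_def
        proof (elim PlusE)
          fix \<alpha> assume "\<alpha> \<in> Z" "i = Inl \<alpha>"
          then show ?thesis using bspec[OF elim(1)] by (simp add: mixed_roots_def del: mem_cball)
        next
          fix V assume "V \<in> far_centers" "i = Inr V"
          then show ?thesis using bspec[OF elim(2)] by (simp add: mixed_roots_def)
        qed
      qed
      moreover have "mixed_roots (\<Phi> t) \<subseteq> (\<Union>i\<in>I. region \<delta> t i)"
      proof
        fix z assume "z \<in> mixed_roots (\<Phi> t)"
        with elim(4) have "(\<exists>\<alpha> \<in> Z. z \<in> cball \<alpha> \<delta>) \<or> (\<exists>V \<in> far_centers. norm (t * cnj z - V) \<le> \<delta>)"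
          by (auto simp: mixed_roots_def Z_def simp del: mem_cball)
        then show "z \<in> (\<Union>i\<in>I. region \<delta> t i)"
        proof (elim disjE bexE)
          fix \<alpha> assume "\<alpha> \<in> Z" "z \<in> cball \<alpha> \<delta>"
          then show ?thesis by (intro UN_I[of "Inl \<alpha>"]) (auto simp: I_def)
        next
          fix V assume "V \<in> far_centers" "norm (t * cnj z - V) \<le> \<delta>"
          then show ?thesis by (intro UN_I[of "Inr V"]) (auto simp: I_def)
        qed
      qed
      ultimately show ?case unfolding good_def using elim(1,2,3) by blast
    qed
  qed
  \<comment> \<open>This keeps V - \<delta> positive in modulus, which is what later forces the far
    roots to infinity.\<close>
  moreover have "\<forall>\<^sub>F \<delta> in at_right 0. \<forall>V\<in>far_centers. \<delta> < norm V"
    using finite_far_centers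
  proof (rule eventually_ball_finite, intro ballI)
    fix V assume "V \<in> far_centers"
    then have "\<forall>\<^sub>F \<delta> in at_right 0. \<delta> \<in> {0<..<norm V}"
      by (intro eventually_at_right_real) (simp add: far_centers_def)
    then show "\<forall>\<^sub>F \<delta> in at_right 0. \<delta> < norm V" by eventually_elim simp
  qed
  ultimately have "\<forall>\<^sub>F \<delta> in at_right 0. (\<forall>\<^sub>F t in at 0. good \<delta> t) \<and> (\<forall>V\<in>far_centers. \<delta> < norm V)"
    by (rule eventually_conj)
  then obtain \<delta> where ev_good: "\<forall>\<^sub>F t in at 0. good \<delta> t" and \<delta>: "\<And>V. V \<in> far_centers \<Longrightarrow> \<delta> < norm V"
    using eventually_happens'[OF trivial_limit_at_right_real] by blast
  then obtain t0 where t0: "t0 > 0" "\<And>t. 0 < norm t \<Longrightarrow> norm t < t0 \<Longrightarrow> good \<delta> t"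
    by (auto simp: eventually_at)
  \<comment> \<open>For t outside the good range \<open>THE\<close> gives an unspecified value; the
    claims concern only good t and limits at 0.\<close>
  define r where "r i t = (THE z. z \<in> region \<delta> t i \<and> z \<in> mixed_roots (\<Phi> t))" for i t
  have r: "r i t \<in> region \<delta> t i" "\<Phi> t (r i t) = 0" if "i \<in> I" "good \<delta> t" for i t
  proof -
    have "\<exists>!z. z \<in> region \<delta> t i \<and> z \<in> mixed_roots (\<Phi> t)"
      using goodD(1)[OF that(2)] that(1) by (rule bspec)
    from theI'[OF this] show "r i t \<in> region \<delta> t i" "\<Phi> t (r i t) = 0"
      unfolding r_def mixed_roots_def by auto
  qed
  have r_near: "r (Inl \<alpha>) t \<in> cball \<alpha> \<delta>" "\<Phi> t (r (Inl \<alpha>) t) = 0" if "\<alpha> \<in> Z" "good \<delta> t" for \<alpha> t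
    using r[of "Inl \<alpha>" t] that by (auto simp: I_def)
  have r_far: "norm (t * cnj (r (Inr V) t) - V) \<le> \<delta>" "\<Phi> t (r (Inr V) t) = 0"
    if "V \<in> far_centers" "good \<delta> t" for V t
    using r[of "Inr V" t] that by (auto simp: I_def)
  show ?thesis
  proof (rule that[OF t0(1), of r])
    fix t :: complex assume "0 < norm t" "norm t < t0"
    then have "good \<delta> t" by (rule t0)
    then show "bij_betw (\<lambda>i. r i t) (mixed_roots (\<Phi> 0) <+> far_centers) (mixed_roots (\<Phi> t))"
      unfolding r_def Z_def[symmetric] I_def[symmetric]
      using goodD(1,5,6)[of \<delta> t] by (intro bij_betw_unique_zeros) simp_all
  next
    fix \<alpha> assume \<alpha>: "\<alpha> \<in> mixed_roots (\<Phi> 0)"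
    have "((\<lambda>t. \<Phi> t \<alpha>) \<longlongrightarrow> \<Phi> 0 \<alpha>) (at 0)"
      by (rule iffD2[OF tendsto_at_iff_tendsto_nhds \<Phi>_tendsto])
    then have "((\<lambda>t. \<Phi> t \<alpha>) \<longlongrightarrow> 0) (at 0)" using \<alpha> by (simp add: mixed_roots_def)
    then have "((\<lambda>t. K \<alpha> * norm (\<Phi> t \<alpha>)) \<longlongrightarrow> 0) (at 0)"
      by (intro tendsto_mult_right_zero tendsto_norm_zero)
    \<comment> \<open>The uniform bound from \<open>near_root\<close> gives convergence without
      shrinking \<delta>.\<close>
    moreover have "\<forall>\<^sub>F t in at 0. norm (r (Inl \<alpha>) t - \<alpha>) \<le> K \<alpha> * norm (\<Phi> t \<alpha>)"
      using ev_good
    proof eventually_elim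
      case (elim t)
      then show ?case using r_near[of \<alpha> t] \<alpha> goodD(3)[OF elim] unfolding Z_def by blast
    qed
    ultimately have "((\<lambda>t. r (Inl \<alpha>) t - \<alpha>) \<longlongrightarrow> 0) (at 0)"
      by (rule Lim_null_comparison[rotated])
    then show "(r (Inl \<alpha>) \<longlongrightarrow> \<alpha>) (at 0)" by (rule Lim_null[THEN iffD2])
  next
    fix \<alpha> t assume "\<alpha> \<in> mixed_roots (\<Phi> 0)" "0 < norm (t::complex)" "norm t < t0"
    then show "sgn (mixed_jacobian (\<Phi> t) (r (Inl \<alpha>) t)) = sgn (mixed_jacobian (\<Phi> 0) \<alpha>)"
      using r_near[of \<alpha> t] t0(2)[of t] goodD(2)[of \<delta> t] unfolding Z_def by blast
  next
    fix V t assume "V \<in> far_centers" "0 < norm (t::complex)" "norm t < t0"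
    then show "mixed_jacobian (\<Phi> t) (r (Inr V) t) < 0"
      using r_far[of V t] t0(2)[of t] goodD(4)[of \<delta> t] by blast
  next
    fix V assume V: "V \<in> far_centers"
    define c where "c = norm V - \<delta>"
    have c: "c > 0" using \<delta>[OF V] by (simp add: c_def)
    \<comment> \<open>From |V| - \<delta> \<le> |t| |z| the far root has modulus at least
      c/|t|.\<close>
    have "filterlim (\<lambda>t::complex. c * norm (inverse t)) at_top (at 0)"
      by (intro filterlim_tendsto_pos_mult_at_top[OF tendsto_const c]
          filterlim_at_infinity_imp_norm_at_top filterlim_inverse_at_infinity)
    moreover have "\<forall>\<^sub>F t in at 0. c * norm (inverse t) \<le> norm (r (Inr V) t)"
      using ev_good eventually_neq_at_within[of 0]
    proof eventually_elim
      case (elim t)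
      have "norm V \<le> \<delta> + norm t * norm (r (Inr V) t)"
        using r_far(1)[OF V elim(1)] norm_triangle_sub[of V "t * cnj (r (Inr V) t)"]
        by (simp add: norm_minus_commute norm_mult)
      then have "c / norm t \<le> norm (r (Inr V) t)"
        using elim(2) by (simp add: c_def pos_divide_le_eq mult.commute)
      then show ?case by (simp add: norm_inverse divide_inverse)
    qed
    ultimately have "filterlim (\<lambda>t. norm (r (Inr V) t)) at_top (at 0)"
      by (rule filterlim_at_top_mono)
    then show "filterlim (r (Inr V)) at_infinity (at 0)"
      by (rule filterlim_norm_at_top_imp_at_infinity)
  qed
qed

end

section \<open>Lens polynomials with the maximal number of roots\<close>

text \<open>Counting the elements of W below a point gives a strictly increasing map from Z into {0,
  ..., card W}.\<close>

lemma interlacing: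
  fixes Z W :: "real set"
  assumes W: "finite W" and sep: "\<And>a b. a \<in> Z \<Longrightarrow> b \<in> Z \<Longrightarrow> a < b \<Longrightarrow> \<exists>w\<in>W. a < w \<and> w < b"
  shows "finite Z" "card Z \<le> card W + 1"
proof -
  define g where "g z = card {w \<in> W. w < z}" for z
  have mono: "g a < g b" if "a \<in> Z" "b \<in> Z" "a < b" for a b
  proof -
    obtain w where "w \<in> W" "a < w" "w < b" using sep[OF \<open>a \<in> Z\<close> \<open>b \<in> Z\<close> \<open>a < b\<close>] by auto
    then have "w \<in> {w \<in> W. w < b}" "w \<notin> {w \<in> W. w < a}" by auto
    moreover have "{w \<in> W. w < a} \<subseteq> {w \<in> W. w < b}" using \<open>a < b\<close> by auto
    ultimately have "{w \<in> W. w < a} \<subset> {w \<in> W. w < b}" by blast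
    then show ?thesis unfolding g_def using W by (intro psubset_card_mono) auto
  qed
  have inj: "inj_on g Z"
  proof (rule inj_onI)
    fix a b assume "a \<in> Z" "b \<in> Z" "g a = g b"
    then show "a = b" using mono[of a b] mono[of b a] by (cases a b rule: linorder_cases) auto
  qed
  have img: "g ` Z \<subseteq> {..card W}"
    unfolding g_def using W by (auto intro!: card_mono)
  show "finite Z" using inj img finite_imageD finite_subset by blast
  show "card Z \<le> card W + 1" using card_inj_on_le[OF inj img] by simp
qed

text \<open>A common point x could be dropped from W: an interval (a, b) around x still meets W
  inside (a, x), because x also lies in Z. The smaller W would then bound card Z too sharply. With W
  the zeros of the derivative, this yields simplicity of the roots from their number alone.\<close>

lemma interlacing_disjoint:
  fixes Z W :: "real set"
  assumes W: "finite W" and sep: "\<And>a b. a \<in> Z \<Longrightarrow> b \<in> Z \<Longrightarrow> a < b \<Longrightarrow> \<exists>w\<in>W. a < w \<and> w < b"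
    and card: "card W < card Z"
  shows "Z \<inter> W = {}"
proof (rule ccontr)
  assume "Z \<inter> W \<noteq> {}"
  then obtain x where x: "x \<in> Z" "x \<in> W" by auto
  have sep': "\<exists>w\<in>W - {x}. a < w \<and> w < b" if "a \<in> Z" "b \<in> Z" "a < b" for a b
  proof (cases "a < x \<and> x < b")
    case True
    then obtain w where "w \<in> W" "a < w" "w < x" using sep[OF \<open>a \<in> Z\<close> x(1)] by auto
    then show ?thesis using True by (intro bexI[of _ w]) auto
  next
    case False
    then show ?thesis using sep[of a b] that by auto
  qed
  have "card Z \<le> card (W - {x}) + 1"
    by (rule interlacing(2)[OF finite_Diff[OF W] sep'])
  also have "\<dots> = card W" using card.remove[OF W x(2)] by simp
  finally show False using card by simp
qed

section \<open>Counting points on the rays where z^N is real\<close>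

lemma card_le_1I:
  assumes "\<And>x y. x \<in> A \<Longrightarrow> y \<in> A \<Longrightarrow> x = y"
  shows "finite A" "card A \<le> 1"
proof -
  have "A = {} \<or> (\<exists>x. A = {x})"
  proof (cases "A = {}")
    case False
    then obtain x where "x \<in> A" by auto
    moreover from this have "y = x" if "y \<in> A" for y using assms that by blast
    ultimately have "A = {x}" by blast
    then show ?thesis by simp
  qed simp
  then show "finite A" "card A \<le> 1" by auto
qed

lemma power_eq_positive:
  fixes a b :: real
  assumes "a > 0" "b > 0" "N > 0" "a ^ N = b ^ N"
  shows "a = b"
  using assms by (simp add: power_eq_iff_eq_base)

text \<open>Each admissible modulus s contributes N points, the N-th roots of s^N or of -s^N. Fibres
  with different moduli are disjoint, and so are the two signs at a common modulus.\<close>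

lemma card_power_fibres:
  assumes N: "N > 0" and P: "finite P" "P \<subseteq> {0<..}" and Q: "finite Q" "Q \<subseteq> {0<..}"
  defines "Y \<equiv> {z::complex. norm z \<in> P \<and> z ^ N = of_real (norm z ^ N) \<or> norm z \<in> Q \<and> z ^ N = - of_real (norm z ^ N)}"
  shows "finite Y" "card Y = N * (card P + card Q)"
proof -
  define A where "A s = {z::complex. z ^ N = of_real (s ^ N)}" for s :: real
  define B where "B s = {z::complex. z ^ N = - of_real (s ^ N)}" for s :: real
  have nA: "norm z = s" if "z \<in> A s" "s > 0" for z s
  proof -
    have "norm (z ^ N) = s ^ N" using that by (simp add: A_def del: of_real_power)
    then have "norm z ^ N = s ^ N" by (simp add: norm_power)
    then show ?thesis using that N by (simp add: power_eq_iff_eq_base)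
  qed
  have nB: "norm z = s" if "z \<in> B s" "s > 0" for z s
  proof -
    have "norm (z ^ N) = s ^ N" using that by (simp add: B_def del: of_real_power)
    then have "norm z ^ N = s ^ N" by (simp add: norm_power)
    then show ?thesis using that N by (simp add: power_eq_iff_eq_base)
  qed
  have cA: "card (A s) = N" "finite (A s)" if "s > 0" for s
  proof -
    show "card (A s) = N" unfolding A_def using that N by (intro card_nth_roots) auto
    then show "finite (A s)" using N by (intro card_ge_0_finite) auto
  qed
  have cB: "card (B s) = N" "finite (B s)" if "s > 0" for s
  proof -
    show "card (B s) = N" unfolding B_def using that N by (intro card_nth_roots) auto
    then show "finite (B s)" using N by (intro card_ge_0_finite) auto
  qed
  have Y: "Y = (\<Union>s\<in>P. A s) \<union> (\<Union>s\<in>Q. B s)"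
  proof (intro equalityI subsetI)
    fix z assume "z \<in> Y"
    then show "z \<in> (\<Union>s\<in>P. A s) \<union> (\<Union>s\<in>Q. B s)" by (auto simp: Y_def A_def B_def)
  next
    fix z assume "z \<in> (\<Union>s\<in>P. A s) \<union> (\<Union>s\<in>Q. B s)"
    then consider s where "s \<in> P" "z \<in> A s" | s where "s \<in> Q" "z \<in> B s" by auto
    then show "z \<in> Y"
    proof cases
      case 1
      then have "norm z = s" using nA P by auto
      then show ?thesis using 1 by (simp add: Y_def A_def)
    next
      case 2
      then have "norm z = s" using nB Q by auto
      then show ?thesis using 2 by (simp add: Y_def B_def)
    qed
  qed
  have finA: "finite (\<Union>s\<in>P. A s)" and finB: "finite (\<Union>s\<in>Q. B s)"
    using P Q cA cB by auto
  then show "finite Y" by (simp add: Y)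
  have "card (\<Union>s\<in>P. A s) = (\<Sum>s\<in>P. card (A s))"
    using P nA cA by (intro card_UN_disjoint) (auto, blast)
  also have "\<dots> = (\<Sum>s\<in>P. N)" using P cA by (intro sum.cong) auto
  finally have 1: "card (\<Union>s\<in>P. A s) = N * card P" by simp
  have "card (\<Union>s\<in>Q. B s) = (\<Sum>s\<in>Q. card (B s))"
    using Q nB cB by (intro card_UN_disjoint) (auto, blast)
  also have "\<dots> = (\<Sum>s\<in>Q. N)" using Q cB by (intro sum.cong) auto
  finally have 2: "card (\<Union>s\<in>Q. B s) = N * card Q" by simp
  have "(\<Union>s\<in>P. A s) \<inter> (\<Union>s\<in>Q. B s) = {}"
  proof (rule equals0I)
    fix z assume "z \<in> (\<Union>s\<in>P. A s) \<inter> (\<Union>s\<in>Q. B s)"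
    then obtain s s' where s: "s \<in> P" "z \<in> A s" "s' \<in> Q" "z \<in> B s'" by auto
    then have "s > 0" "s' > 0" using P Q by auto
    then have "s' = s" using nA nB s by metis
    with s have "of_real (s ^ N) = - (of_real (s ^ N) :: complex)"
      unfolding A_def B_def mem_Collect_eq by metis
    then have "s ^ N = - (s ^ N)" by (metis of_real_eq_iff of_real_minus)
    then show False using \<open>s > 0\<close> by auto
  qed
  then show "card Y = N * (card P + card Q)"
    unfolding Y using card_Un_disjoint[OF finA finB] 1 2 by (simp add: algebra_simps)
qed

lemma power_on_real_ray:
  fixes z :: complex
  assumes "z ^ N * of_real a = of_real c" "a \<noteq> 0"
  shows "z ^ N = of_real (norm z ^ N) \<or> z ^ N = - of_real (norm z ^ N)"
proof -
  have eq: "z ^ N = of_real (c / a)" using assms by (simp add: field_simps)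
  then have "norm z ^ N = \<bar>c / a\<bar>" by (metis norm_of_real norm_power)
  then have "c / a = norm z ^ N \<or> c / a = - (norm z ^ N)" by linarith
  then show ?thesis unfolding eq by (metis of_real_minus)
qed

text \<open>
  For \<open>z\<^sup>N = \<sigma> |z|\<^sup>N\<close> the lens polynomial of \<open>rhie_lens_large\<close> takes the value \<open>rhie_M N \<sigma> |z|\<close> at
  \<open>z\<close>. The numerator \<open>rhie_k\<close> of the derivative of \<open>s \<mapsto> rhie_M N \<sigma> s / s\<^sup>N\<close> serves both Rolle's theorem
  and simplicity: at such a root the Jacobian is a nonzero multiple of it.
\<close>

definition rhie_M :: "nat \<Rightarrow> real \<Rightarrow> real \<Rightarrow> real" where
  "rhie_M N \<sigma> s = \<sigma> * s ^ N * (s\<^sup>2 - 2) - (s\<^sup>2 / 2 - 1 / 1024)"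

definition rhie_k :: "nat \<Rightarrow> real \<Rightarrow> real \<Rightarrow> real" where
  "rhie_k N \<sigma> s = 2 * \<sigma> * s ^ (N + 2) + (real N - 2) / 2 * s\<^sup>2 - real N / 1024"

lemma rhie_rolle:
  assumes "0 < a" "a < b" "rhie_M N \<sigma> a = 0" "rhie_M N \<sigma> b = 0" "N > 0"
  shows "\<exists>w\<in>{s. s > 0 \<and> rhie_k N \<sigma> s = 0}. a < w \<and> w < b"
proof -
  have der: "((\<lambda>s. rhie_M N \<sigma> s / s ^ N) has_real_derivative rhie_k N \<sigma> x / x ^ (N + 1)) (at x)"
    if "x > 0" for x
  proof -
    \<comment> \<open>With \<open>x ^ N = x * X\<close> the numerator becomes a polynomial identity
      free of the exponent N - 1.\<close>
    define X where "X = x ^ (N - 1)"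
    have X: "x ^ N = x * X" "X \<noteq> 0"
      using power_minus_mult[OF assms(5), of x] that by (simp_all add: X_def mult.commute)
    have "((\<lambda>s. rhie_M N \<sigma> s / s ^ N) has_real_derivative
       ((\<sigma> * (real N * x ^ (N - 1)) * (x\<^sup>2 - 2) + \<sigma> * x ^ N * (2 * x) - x) * x ^ N
         - rhie_M N \<sigma> x * (real N * x ^ (N - 1))) / (x ^ N * x ^ N)) (at x)"
      unfolding rhie_M_def using that by (auto intro!: derivative_eq_intros simp: algebra_simps)
    moreover have "(\<sigma> * (real N * x ^ (N - 1)) * (x\<^sup>2 - 2) + \<sigma> * x ^ N * (2 * x) - x) * x ^ N
         - rhie_M N \<sigma> x * (real N * x ^ (N - 1)) = rhie_k N \<sigma> x * X"
      unfolding rhie_M_def rhie_k_def power_add X_def[symmetric] X(1)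
      by (simp add: algebra_simps power2_eq_square add_divide_distrib diff_divide_distrib)
    moreover have "rhie_k N \<sigma> x * X / (x ^ N * x ^ N) = rhie_k N \<sigma> x / x ^ (N + 1)"
      unfolding power_add X(1) using X(2) that by simp
    ultimately show ?thesis by simp
  qed
  have "\<exists>z. a < z \<and> z < b \<and> rhie_k N \<sigma> z / z ^ (N + 1) = 0"
  proof -
    have "continuous_on {a..b} (\<lambda>s. rhie_M N \<sigma> s / s ^ N)"
      using assms(1) by (intro continuous_at_imp_continuous_on ballI DERIV_isCont[OF der]) auto
    moreover have "rhie_M N \<sigma> a / a ^ N = rhie_M N \<sigma> b / b ^ N" using assms by simp
    moreover have "((\<lambda>s. rhie_M N \<sigma> s / s ^ N) has_derivative (\<lambda>h. rhie_k N \<sigma> x / x ^ (N + 1) * h)) (at x)"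
      if "a < x" "x < b" for x
      by (rule has_field_derivative_imp_has_derivative[OF der]) (use that assms(1) in simp)
    ultimately obtain z where "a < z" "z < b" "(\<lambda>h. rhie_k N \<sigma> z / z ^ (N + 1) * h) = (\<lambda>v. 0)"
      using Rolle_deriv[OF assms(2), of "\<lambda>s. rhie_M N \<sigma> s / s ^ N" "\<lambda>x h. rhie_k N \<sigma> x / x ^ (N + 1) * h"]
      by blast
    then show ?thesis by (metis mult.right_neutral)
  qed
  then obtain z where "a < z" "z < b" "rhie_k N \<sigma> z = 0" using assms(1) by auto
  then show ?thesis using assms(1) by (intro bexI[of _ z]) auto
qed

section \<open>Positive zeros of the radial equation: upper bounds by Rolle, lower bounds by sign
  changes\<close>

definition rhie_Z :: "nat \<Rightarrow> real \<Rightarrow> real set" where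
  "rhie_Z N \<sigma> = {s. s > 0 \<and> rhie_M N \<sigma> s = 0}"

definition rhie_W :: "nat \<Rightarrow> real \<Rightarrow> real set" where
  "rhie_W N \<sigma> = {s. s > 0 \<and> rhie_k N \<sigma> s = 0}"

lemma rhie_sep:
  assumes "N > 0" "a \<in> rhie_Z N \<sigma>" "b \<in> rhie_Z N \<sigma>" "a < b"
  shows "\<exists>w\<in>rhie_W N \<sigma>. a < w \<and> w < b"
  using rhie_rolle[of a b N \<sigma>] assms by (simp add: rhie_Z_def rhie_W_def)

text \<open>For \<sigma> = 1 both non-constant terms of \<open>rhie_k\<close> increase strictly,
  since N > 2.\<close>

lemma rhie_W_pos:
  assumes N: "N \<ge> 3"
  shows "finite (rhie_W N 1)" "card (rhie_W N 1) \<le> 1"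
proof -
  have less: "rhie_k N 1 x < rhie_k N 1 y" if "0 < x" "x < y" for x y
  proof -
    have "x ^ (N + 2) < y ^ (N + 2)" "x\<^sup>2 < y\<^sup>2"
      using that by (intro power_strict_mono; simp)+
    moreover have "(real N - 2) / 2 > 0" using N by simp
    ultimately have "2 * x ^ (N + 2) < 2 * y ^ (N + 2)" "(real N - 2) / 2 * x\<^sup>2 < (real N - 2) / 2 * y\<^sup>2"
      by (simp_all only: mult_strict_left_mono zero_less_numeral)
    then show ?thesis unfolding rhie_k_def by simp
  qed
  have "x = y" if "x \<in> rhie_W N 1" "y \<in> rhie_W N 1" for x y
    using that less[of x y] less[of y x]
    by (cases x y rule: linorder_cases) (auto simp: rhie_W_def)
  then show "finite (rhie_W N 1)" "card (rhie_W N 1) \<le> 1" using card_le_1I by metis+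
qed

text \<open>A second use of Rolle: the derivative of \<open>rhie_k\<close> for \<sigma> = -1 has at
  most one positive zero, and D contains it.\<close>

lemma rhie_W_neg:
  assumes N: "N \<ge> 3"
  shows "finite (rhie_W N (- 1))" "card (rhie_W N (- 1)) \<le> 2"
proof -
  define D where "D = {s::real. s > 0 \<and> s ^ N = (real N - 2) / (2 * (real N + 2))}"
  have D: "finite D" "card D \<le> 1"
  proof -
    have "x = y" if "x \<in> D" "y \<in> D" for x y
      using that N power_eq_positive[of x y N] by (auto simp: D_def)
    then show "finite D" "card D \<le> 1" using card_le_1I by metis+
  qed
  have sep: "\<exists>w\<in>D. a < w \<and> w < b" if ab: "a \<in> rhie_W N (- 1)" "b \<in> rhie_W N (- 1)" "a < b" for a b
  proof -
    have der: "(rhie_k N (- 1) has_real_derivative x * ((real N - 2) - 2 * (real N + 2) * x ^ N)) (at x)" for x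
      unfolding rhie_k_def by (rule derivative_eq_intros refl)+ (simp add: algebra_simps add_divide_distrib diff_divide_distrib)
    have "continuous_on {a..b} (rhie_k N (- 1))"
      by (intro continuous_at_imp_continuous_on ballI DERIV_isCont[OF der])
    moreover have "rhie_k N (- 1) a = rhie_k N (- 1) b" using ab by (simp add: rhie_W_def)
    moreover have "(rhie_k N (- 1) has_derivative (\<lambda>h. x * ((real N - 2) - 2 * (real N + 2) * x ^ N) * h)) (at x)" for x
      by (rule has_field_derivative_imp_has_derivative[OF der])
    ultimately obtain z where z: "a < z" "z < b"
      "(\<lambda>h. z * ((real N - 2) - 2 * (real N + 2) * z ^ N) * h) = (\<lambda>v. 0)"
      using Rolle_deriv[OF \<open>a < b\<close>, of "rhie_k N (- 1)" "\<lambda>x h. x * ((real N - 2) - 2 * (real N + 2) * x ^ N) * h"]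
      by blast
    then have "z * ((real N - 2) - 2 * (real N + 2) * z ^ N) = 0" by (metis mult.right_neutral)
    moreover have "z > 0" using z ab by (simp add: rhie_W_def)
    ultimately have "(real N - 2) - 2 * (real N + 2) * z ^ N = 0" by simp
    then have "z \<in> D" using \<open>z > 0\<close> by (simp add: D_def field_simps)
    then show ?thesis using z by blast
  qed
  note inter = interlacing[where Z = "rhie_W N (- 1)", OF D(1) sep]
  show "finite (rhie_W N (- 1))" by (rule inter)
  show "card (rhie_W N (- 1)) \<le> 2" using inter(2) D by simp
qed

lemma rhie_continuous: "continuous_on A (rhie_M N \<sigma>)"
  unfolding rhie_M_def[abs_def] by (intro continuous_intros) auto

lemma rhie_Z_between:
  assumes "0 \<le> a" "a < b" "rhie_M N \<sigma> a * rhie_M N \<sigma> b < 0"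
  obtains s where "a < s" "s < b" "s \<in> rhie_Z N \<sigma>"
proof -
  have "\<exists>s\<ge>a. s \<le> b \<and> rhie_M N \<sigma> s = 0"
  proof (cases "rhie_M N \<sigma> a < 0")
    case True
    then show ?thesis using assms by (intro IVT' rhie_continuous) (auto simp: mult_less_0_iff)
  next
    case False
    then show ?thesis using assms by (intro IVT2' rhie_continuous) (auto simp: mult_less_0_iff)
  qed
  then obtain s where s: "a \<le> s" "s \<le> b" "rhie_M N \<sigma> s = 0" by auto
  have "s \<noteq> a" "s \<noteq> b" using s assms(3) by auto
  then show ?thesis using s assms(1) by (intro that[of s]) (auto simp: rhie_Z_def)
qed

text \<open>The signs +, -, + at 0, 1, 2 give two zeros, the most that \<open>rhie_W_pos\<close>
  permits; extremality then makes \<open>interlacing_disjoint\<close> applicable.\<close>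

lemma rhie_Z_pos:
  assumes N: "N \<ge> 3"
  shows "finite (rhie_Z N 1)" "card (rhie_Z N 1) = 2" "rhie_Z N 1 \<inter> rhie_W N 1 = {}"
proof -
  have N0: "N > 0" using N by simp
  have M0: "rhie_M N 1 0 > 0" using N0 by (simp add: rhie_M_def zero_power)
  have M1: "rhie_M N 1 1 < 0" by (simp add: rhie_M_def)
  have "(2::real) ^ N \<ge> 2 ^ 3" using N by (intro power_increasing) auto
  then have M2: "rhie_M N 1 2 > 0" by (simp add: rhie_M_def)
  obtain s1 where s1: "0 < s1" "s1 < 1" "s1 \<in> rhie_Z N 1"
    using rhie_Z_between[of 0 1 N 1] M0 M1 by (auto simp: mult_less_0_iff)
  obtain s2 where s2: "1 < s2" "s2 < 2" "s2 \<in> rhie_Z N 1"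
    using rhie_Z_between[of 1 2 N 1] M2 M1 by (auto simp: mult_less_0_iff)
  note inter = interlacing[where Z = "rhie_Z N 1", OF rhie_W_pos(1)[OF N] rhie_sep[OF N0]]
  show fin: "finite (rhie_Z N 1)" by (rule inter)
  have "card {s1, s2} \<le> card (rhie_Z N 1)" using s1 s2 fin by (intro card_mono) auto
  then have ge: "card (rhie_Z N 1) \<ge> 2" using s1 s2 by (simp add: card_insert_if)
  then show "card (rhie_Z N 1) = 2" using inter(2) rhie_W_pos(2)[OF N] by simp
  show "rhie_Z N 1 \<inter> rhie_W N 1 = {}"
    using ge rhie_W_pos(2)[OF N] by (intro interlacing_disjoint rhie_W_pos N rhie_sep[OF N0]) auto
qed

text \<open>As for \<sigma> = 1, now with signs +, -, +, - at 0, 1/16, 1, 2.\<close>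

lemma rhie_Z_neg:
  assumes N: "N \<ge> 3"
  shows "finite (rhie_Z N (- 1))" "card (rhie_Z N (- 1)) = 3" "rhie_Z N (- 1) \<inter> rhie_W N (- 1) = {}"
proof -
  have N0: "N > 0" using N by simp
  have M0: "rhie_M N (- 1) 0 > 0" using N0 by (simp add: rhie_M_def zero_power)
  \<comment> \<open>At 1/16 the part without s^N is 1/1024 - 1/512 = -1/1024, while the power term
    is at most 2/16^3 = 1/2048. This uses N \<ge> 3.\<close>
  have "(1 / 16 :: real) ^ N \<le> (1 / 16) ^ 3" using N by (intro power_decreasing) auto
  moreover have "(1 / 16 :: real) ^ N * (2 - (1 / 16)\<^sup>2) \<le> (1 / 16) ^ N * 2" by (intro mult_left_mono) auto
  ultimately have Ms: "rhie_M N (- 1) (1 / 16) < 0"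
    by (simp add: rhie_M_def power2_eq_square power3_eq_cube algebra_simps)
  have M1: "rhie_M N (- 1) 1 > 0" by (simp add: rhie_M_def)
  have "(2::real) ^ N \<ge> 2 ^ 3" using N by (intro power_increasing) auto
  then have M2: "rhie_M N (- 1) 2 < 0" by (simp add: rhie_M_def)
  obtain s1 where s1: "0 < s1" "s1 < 1/16" "s1 \<in> rhie_Z N (- 1)"
    using rhie_Z_between[of 0 "1/16" N "- 1"] M0 Ms by (auto simp: mult_less_0_iff)
  obtain s2 where s2: "1/16 < s2" "s2 < 1" "s2 \<in> rhie_Z N (- 1)"
    using rhie_Z_between[of "1/16" 1 N "- 1"] M1 Ms by (auto simp: mult_less_0_iff)
  obtain s3 where s3: "1 < s3" "s3 < 2" "s3 \<in> rhie_Z N (- 1)"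
    using rhie_Z_between[of 1 2 N "- 1"] M2 M1 by (auto simp: mult_less_0_iff)
  note inter = interlacing[where Z = "rhie_Z N (- 1)", OF rhie_W_neg(1)[OF N] rhie_sep[OF N0]]
  show fin: "finite (rhie_Z N (- 1))" by (rule inter)
  have "card {s1, s2, s3} \<le> card (rhie_Z N (- 1))" using s1 s2 s3 fin by (intro card_mono) auto
  then have ge: "card (rhie_Z N (- 1)) \<ge> 3" using s1 s2 s3 by (simp add: card_insert_if)
  then show "card (rhie_Z N (- 1)) = 3" using inter(2) rhie_W_neg(2)[OF N] by simp
  show "rhie_Z N (- 1) \<inter> rhie_W N (- 1) = {}"
    using ge rhie_W_neg(2)[OF N] by (intro interlacing_disjoint rhie_W_neg N rhie_sep[OF N0]) auto
qed

section \<open>Explicit extremal lens polynomials in every degree\<close>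

lemma norm_sq_eq: "cnj z * z = of_real ((norm z)\<^sup>2)"
  by (simp only: complex_norm_square mult.commute)

lemma simple_root_lensI:
  assumes "lens_poly p q z = 0"
    and "norm (cnj z * poly (pderiv q) z - poly (pderiv p) z) \<noteq> norm (poly q z)"
  shows "simple_root (lens_poly p q) z"
  using assms mixed_jacobian_wirtinger[OF wirtinger_lens[of p q z]]
  by (simp add: simple_root_iff)

text \<open>The quotient p/q has N equal poles at the vertices z^N = 1/2 of a regular polygon and a
  weak pole at 0 of residue 1/512. The rays with \<sigma> = 1 and \<sigma> = -1 carry 2 and 3
  moduli, giving N (2 + 3) roots.\<close>

lemma rhie_lens_large:
  assumes N: "N \<ge> 3"
  shows "\<exists>p q. rhie_lens (N + 1) p q"
proof -
  define q :: "complex poly" where "q = monom 1 (N + 1) + [:0, - 1 / 2:]"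
  define p :: "complex poly" where "p = monom 2 N + [:- 1 / 1024:]"
  define f where "f = lens_poly p q"
  have deg_q: "degree q = N + 1"
    unfolding q_def using N by (subst degree_add_eq_left) (auto simp: degree_monom_eq)
  have deg_p: "degree p \<le> N + 1"
    unfolding p_def by (rule degree_add_le) (auto intro: order_trans[OF degree_monom_le])
  have fz: "f z = z ^ N * (cnj z * z - 2) - (cnj z * z / 2 - 1 / 1024)" for z
    by (simp add: f_def lens_poly_def p_def q_def poly_monom algebra_simps)
  have f_ray: "f z = of_real (rhie_M N \<sigma> (norm z))" if "z ^ N = of_real (\<sigma> * norm z ^ N)" for z \<sigma>
    unfolding fz norm_sq_eq that by (simp add: rhie_M_def)
  define Y where "Y = {z::complex. norm z \<in> rhie_Z N 1 \<and> z ^ N = of_real (norm z ^ N) \<or>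
      norm z \<in> rhie_Z N (- 1) \<and> z ^ N = - of_real (norm z ^ N)}"
  have ray: "\<exists>\<sigma>. (\<sigma> = 1 \<or> \<sigma> = - 1) \<and> z ^ N = of_real (\<sigma> * norm z ^ N) \<and> norm z \<in> rhie_Z N \<sigma>"
    if "f z = 0" for z
  proof -
    have "z \<noteq> 0" using that N by (auto simp: fz zero_power)
    define u where "u = (norm z)\<^sup>2"
    have "z ^ N * of_real (u - 2) = of_real (u / 2 - 1 / 1024)"
      using that unfolding fz norm_sq_eq u_def[symmetric] by simp
    moreover have "u - 2 \<noteq> 0"
    proof
      assume "u - 2 = 0"
      then have "of_real (u / 2 - 1 / 1024) = (0::complex)"
        using calculation by (metis mult_zero_right of_real_0)
      then have "u / 2 - 1 / 1024 = 0" by (simp only: of_real_eq_0_iff)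
      then show False using \<open>u - 2 = 0\<close> by simp
    qed
    ultimately have "z ^ N = of_real (norm z ^ N) \<or> z ^ N = - of_real (norm z ^ N)"
      by (rule power_on_real_ray)
    then obtain \<sigma> :: real where \<sigma>: "\<sigma> = 1 \<or> \<sigma> = - 1" "z ^ N = of_real (\<sigma> * norm z ^ N)"
      by (metis mult_1 mult_minus1 of_real_minus)
    have "rhie_M N \<sigma> (norm z) = 0" using f_ray[OF \<sigma>(2)] that by (metis of_real_eq_0_iff)
    then show ?thesis using \<sigma> \<open>z \<noteq> 0\<close> by (auto simp: rhie_Z_def)
  qed
  have roots: "mixed_roots f = Y"
  proof (intro equalityI subsetI)
    fix z assume "z \<in> mixed_roots f"
    then obtain \<sigma> where "\<sigma> = 1 \<or> \<sigma> = - 1" "z ^ N = of_real (\<sigma> * norm z ^ N)" "norm z \<in> rhie_Z N \<sigma>"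
      using ray[of z] by (auto simp: mixed_roots_def)
    then show "z \<in> Y" by (auto simp: Y_def)
  next
    fix z assume "z \<in> Y"
    then show "z \<in> mixed_roots f"
      using f_ray[of z 1] f_ray[of z "- 1"] by (auto simp: Y_def mixed_roots_def rhie_Z_def)
  qed
  have sub: "rhie_Z N \<sigma> \<subseteq> {0<..}" for \<sigma> by (auto simp: rhie_Z_def)
  note card_Y = card_power_fibres[OF _ rhie_Z_pos(1)[OF N] sub rhie_Z_neg(1)[OF N] sub, of N, folded Y_def]
  have "finite (mixed_roots f)" "\<rho> f = 5 * (N + 1) - 5"
    using card_Y N by (simp_all add: roots root_count_def rhie_Z_pos(2) rhie_Z_neg(2))
  moreover have "simple_root f z" if "z \<in> mixed_roots f" for z
  proof -
    have z: "f z = 0" using that by (simp add: mixed_roots_def)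
    obtain \<sigma> where \<sigma>: "\<sigma> = 1 \<or> \<sigma> = - 1" "z ^ N = of_real (\<sigma> * norm z ^ N)" "norm z \<in> rhie_Z N \<sigma>"
      using ray[OF z] by blast
    define s where "s = norm z"
    define X where "X = \<sigma> * s ^ N"
    have s: "s > 0" "rhie_M N \<sigma> s = 0" using \<sigma> by (auto simp: rhie_Z_def s_def)
    have k: "rhie_k N \<sigma> s \<noteq> 0"
      using \<sigma> rhie_Z_pos(3)[OF N] rhie_Z_neg(3)[OF N] s by (auto simp: rhie_W_def s_def)
    have X: "X * (s\<^sup>2 - 2) = s\<^sup>2 / 2 - 1 / 1024" using s(2) by (simp add: rhie_M_def X_def)
    have zN: "z ^ N = of_real X" using \<sigma>(2) by (simp add: X_def s_def)
    have zz: "cnj z * z = of_real (s\<^sup>2)" using norm_sq_eq by (simp add: s_def)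
    \<comment> \<open>Multiplying the two Wirtinger derivatives by z and by \<open>cnj z\<close>
      makes them the real numbers A and B, so degeneracy means A = B or A = -B. The sum A + B is
      \<open>rhie_k\<close>, which is nonzero at roots. The difference vanishes only for s^2 = 2,
      where the root equation fails.\<close>
    define A where "A = s\<^sup>2 * ((real N + 1) * X - 1 / 2) - 2 * real N * X"
    define B where "B = s\<^sup>2 * (X - 1 / 2)"
    define a where "a = cnj z * poly (pderiv q) z - poly (pderiv p) z"
    have "z * a = (cnj z * z) * ((of_nat N + 1) * z ^ N - 1 / 2) - 2 * of_nat N * (z ^ (N - 1) * z)"
      by (simp add: a_def p_def q_def pderiv_add pderiv_monom poly_monom pderiv_pCons algebra_simps)
    also have "z ^ (N - 1) * z = z ^ N" using N by (intro power_minus_mult) auto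
    finally have za: "z * a = of_real A" unfolding zz zN by (simp add: A_def)
    have "cnj z * poly q z = (cnj z * z) * (z ^ N - 1 / 2)"
      by (simp add: q_def poly_monom algebra_simps)
    then have zb: "cnj z * poly q z = of_real B" unfolding zz zN by (simp add: B_def)
    have "norm a \<noteq> norm (poly q z)"
    proof
      assume "norm a = norm (poly q z)"
      then have "norm (z * a) = norm (cnj z * poly q z)" by (simp add: norm_mult)
      then have "\<bar>A\<bar> = \<bar>B\<bar>" unfolding za zb by simp
      then consider "A - B = 0" | "A + B = 0" by linarith
      then show False
      proof cases
        case 1
        have "A - B = real N * (X * (s\<^sup>2 - 2))" by (simp add: A_def B_def algebra_simps)
        then have 0: "X * (s\<^sup>2 - 2) = 0" using 1 N by simp
        moreover have "X \<noteq> 0" using \<sigma>(1) s(1) by (auto simp: X_def)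
        ultimately have "s\<^sup>2 = 2" by simp
        then show False using X 0 by simp
      next
        case 2
        have "A + B = real N * (X * (s\<^sup>2 - 2)) + 2 * s\<^sup>2 * X - s\<^sup>2"
          by (simp add: A_def B_def algebra_simps)
        also have "\<dots> = rhie_k N \<sigma> s"
          unfolding X by (simp add: rhie_k_def X_def power_add algebra_simps power2_eq_square
              add_divide_distrib diff_divide_distrib)
        finally show False using 2 k by simp
      qed
    qed
    then show ?thesis unfolding f_def a_def using z by (intro simple_root_lensI) (auto simp: f_def)
  qed
  ultimately have "rhie_lens (N + 1) p q"
    using deg_q deg_p by (simp add: rhie_lens_def simple_lens_def all_roots_simple_def f_def)
  then show ?thesis by blast
qed

text \<open>Without the point mass at the origin the origin itself becomes a root; this covers degrees 2 and 3.\<close>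

lemma rhie_lens_small:
  fixes b :: real
  assumes N: "N = Suc (Suc k)" and b: "0 < b" "b < 1"
    and P: "{s. s > 0 \<and> s\<^sup>2 * (s ^ N - b) = s ^ N} = P" "finite P"
    and Q: "{s. s > 0 \<and> s\<^sup>2 * (- (s ^ N) - b) = - (s ^ N)} = Q" "finite Q"
    and card: "N * (card P + card Q) + 1 = 5 * N - 5"
    and nd: "\<And>s. s \<in> P \<union> Q \<Longrightarrow> real N * s\<^sup>2 \<noteq> real k"
  shows "\<exists>p q. rhie_lens N p q"
proof -
  define q :: "complex poly" where "q = monom 1 (Suc (Suc k)) + [:- of_real b:]"
  define p :: "complex poly" where "p = monom 1 (Suc k)"
  define f where "f = lens_poly p q"
  have deg_q: "degree q = N"
    unfolding q_def N by (subst degree_add_eq_left) (auto simp: degree_monom_eq)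
  have deg_p: "degree p \<le> N"
    unfolding p_def N by (auto intro: order_trans[OF degree_monom_le])
  \<comment> \<open>After multiplication by z only |z|^2 and z^N occur. The origin must then be
    examined separately.\<close>
  have fz: "z * f z = (cnj z * z) * (z ^ N - of_real b) - z ^ N" for z
    by (simp add: f_def lens_poly_def p_def q_def N poly_monom algebra_simps)
  have f_ray: "z * f z = of_real ((norm z)\<^sup>2 * (\<sigma> * norm z ^ N - b) - \<sigma> * norm z ^ N)"
    if "z ^ N = of_real (\<sigma> * norm z ^ N)" for z \<sigma>
    unfolding fz norm_sq_eq that by simp
  define Y where "Y = {z::complex. norm z \<in> P \<and> z ^ N = of_real (norm z ^ N) \<or>
      norm z \<in> Q \<and> z ^ N = - of_real (norm z ^ N)}"
  have ray: "\<exists>\<sigma>. (\<sigma> = 1 \<and> norm z \<in> P \<or> \<sigma> = - 1 \<and> norm z \<in> Q) \<and> z ^ N = of_real (\<sigma> * norm z ^ N) \<and>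
      (norm z)\<^sup>2 * (\<sigma> * norm z ^ N - b) - \<sigma> * norm z ^ N = 0"
    if "f z = 0" "z \<noteq> 0" for z
  proof -
    define u where "u = (norm z)\<^sup>2"
    have u: "u > 0" using that by (simp add: u_def)
    have "z ^ N * of_real (u - 1) = of_real (u * b)"
      using fz[of z] that unfolding norm_sq_eq u_def[symmetric] by (simp add: algebra_simps)
    moreover have "u - 1 \<noteq> 0"
    proof
      assume "u - 1 = 0"
      then have "of_real (u * b) = (0::complex)"
        using calculation by (metis mult_zero_right of_real_0)
      then have "u * b = 0" by (simp only: of_real_eq_0_iff)
      then show False using u b by simp
    qed
    ultimately have "z ^ N = of_real (norm z ^ N) \<or> z ^ N = - of_real (norm z ^ N)"
      by (rule power_on_real_ray)
    then obtain \<sigma> :: real where \<sigma>: "\<sigma> = 1 \<or> \<sigma> = - 1" "z ^ N = of_real (\<sigma> * norm z ^ N)"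
      by (metis mult_1 mult_minus1 of_real_minus)
    have 0: "(norm z)\<^sup>2 * (\<sigma> * norm z ^ N - b) - \<sigma> * norm z ^ N = 0"
      using f_ray[OF \<sigma>(2)] that by (metis of_real_eq_0_iff mult_zero_right)
    have "\<sigma> = 1 \<and> norm z \<in> P \<or> \<sigma> = - 1 \<and> norm z \<in> Q"
      using \<sigma>(1) 0 that unfolding P(1)[symmetric] Q(1)[symmetric] by auto
    then show ?thesis using \<sigma> 0 by blast
  qed
  have f0: "f 0 = 0" by (simp add: f_def lens_poly_def p_def poly_monom)
  have roots: "mixed_roots f = insert 0 Y"
  proof (intro equalityI subsetI)
    fix z assume z: "z \<in> mixed_roots f"
    show "z \<in> insert 0 Y"
    proof (cases "z = 0")
      case False
      then obtain \<sigma> where "\<sigma> = 1 \<and> norm z \<in> P \<or> \<sigma> = - 1 \<and> norm z \<in> Q" "z ^ N = of_real (\<sigma> * norm z ^ N)"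
        using ray[of z] z by (auto simp: mixed_roots_def)
      then show ?thesis by (auto simp: Y_def)
    qed simp
  next
    fix z assume "z \<in> insert 0 Y"
    then consider "z = 0" | "norm z \<in> P" "z ^ N = of_real (1 * norm z ^ N)"
      | "norm z \<in> Q" "z ^ N = of_real (- 1 * norm z ^ N)" by (auto simp: Y_def)
    then show "z \<in> mixed_roots f"
    proof cases
      case 1
      then show ?thesis using f0 by (simp add: mixed_roots_def)
    next
      case 2
      then have "norm z > 0" and 0: "(norm z)\<^sup>2 * (1 * norm z ^ N - b) - 1 * norm z ^ N = 0"
        unfolding P(1)[symmetric] by auto
      have "z * f z = 0" unfolding f_ray[OF 2(2)] 0 by simp
      then show ?thesis using \<open>norm z > 0\<close> by (simp add: mixed_roots_def)
    next
      case 3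
      then have "norm z > 0" and 0: "(norm z)\<^sup>2 * (- 1 * norm z ^ N - b) - - 1 * norm z ^ N = 0"
        unfolding Q(1)[symmetric] by auto
      have "z * f z = 0" unfolding f_ray[OF 3(2)] 0 by simp
      then show ?thesis using \<open>norm z > 0\<close> by (simp add: mixed_roots_def)
    qed
  qed
  have sub: "P \<subseteq> {0<..}" "Q \<subseteq> {0<..}" using P Q by auto
  then have "0 \<notin> Y" by (auto simp: Y_def)
  moreover note card_Y = card_power_fibres[OF _ P(2) sub(1) Q(2) sub(2), of N, folded Y_def]
  ultimately have "finite (mixed_roots f)" "\<rho> f = 5 * N - 5"
    using card N by (simp_all add: roots root_count_def)
  moreover have "simple_root f z" if "z \<in> mixed_roots f" for z
  proof -
    have z: "f z = 0" using that by (simp add: mixed_roots_def)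
    define a where "a = cnj z * poly (pderiv q) z - poly (pderiv p) z"
    have "norm a \<noteq> norm (poly q z)"
    proof (cases "z = 0")
      case True
      \<comment> \<open>At the origin a = -p'(0), of modulus 1 for k = 0 and 0 otherwise, while
        |q(0)| = b lies strictly between.\<close>
      have "norm a = 0 \<or> norm a = 1"
        using True by (cases k) (auto simp: a_def p_def pderiv_monom poly_monom)
      moreover have "norm (poly q z) = b" using True b by (simp add: q_def poly_monom)
      ultimately show ?thesis using b by auto
    next
      case False
      obtain \<sigma> where \<sigma>: "\<sigma> = 1 \<and> norm z \<in> P \<or> \<sigma> = - 1 \<and> norm z \<in> Q"
        "z ^ N = of_real (\<sigma> * norm z ^ N)"
        "(norm z)\<^sup>2 * (\<sigma> * norm z ^ N - b) - \<sigma> * norm z ^ N = 0"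
        using ray[OF z False] by blast
      define s where "s = norm z"
      define X where "X = \<sigma> * s ^ N"
      have s: "s > 0" using False by (simp add: s_def)
      have X0: "X \<noteq> 0" using \<sigma>(1) s by (auto simp: X_def)
      have X: "s\<^sup>2 * (X - b) = X" using \<sigma>(3) by (simp add: X_def s_def)
      have zN: "z ^ N = of_real X" using \<sigma>(2) by (simp add: X_def s_def)
      have zz: "cnj z * z = of_real (s\<^sup>2)" using norm_sq_eq by (simp add: s_def)
      have "z\<^sup>2 * a = z ^ N * (of_nat N * (cnj z * z) - (of_nat k + 1))"
        by (simp add: a_def p_def q_def N pderiv_add pderiv_monom poly_monom pderiv_pCons
            algebra_simps power2_eq_square)
      then have za: "z\<^sup>2 * a = of_real (X * (real N * s\<^sup>2 - (real k + 1)))"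
        unfolding zz zN by simp
      have "(cnj z * z) * poly q z = (cnj z * z) * (z ^ N - of_real b)"
        by (simp add: q_def N poly_monom)
      then have "(cnj z * z) * poly q z = of_real (s\<^sup>2 * (X - b))" unfolding zz zN by simp
      then have zb: "(cnj z * z) * poly q z = of_real X" unfolding X .
      show ?thesis
      proof
        assume "norm a = norm (poly q z)"
        then have "norm (z\<^sup>2 * a) = norm ((cnj z * z) * poly q z)"
          by (simp add: norm_mult norm_power power2_eq_square)
        then have "\<bar>X * (real N * s\<^sup>2 - (real k + 1))\<bar> = \<bar>X\<bar>"
          unfolding za zb norm_of_real .
        \<comment> \<open>Degeneracy leaves N s^2 = k, excluded by \<open>nd\<close>, or N s^2 = k +
          2 = N, that is s = 1, where the root equation would force b = 0.\<close>
        then have "\<bar>real N * s\<^sup>2 - (real k + 1)\<bar> = 1" using X0 by (simp add: abs_mult)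
        moreover have "real N * s\<^sup>2 \<noteq> real k" using nd[of s] \<sigma>(1) by (auto simp: s_def)
        ultimately have "real N * s\<^sup>2 = real N" unfolding N by linarith
        then have "s\<^sup>2 = 1" by (simp add: N)
        then show False using X b by simp
      qed
    qed
    then show ?thesis unfolding f_def a_def using z by (intro simple_root_lensI) (auto simp: f_def)
  qed
  ultimately have "rhie_lens N p q"
    using deg_q deg_p by (simp add: rhie_lens_def simple_lens_def all_roots_simple_def f_def)
  then show ?thesis by blast
qed

text \<open>For N = 2 the factor s^2 cancels and the radial equation is linear in s^2. One modulus
  for each sign, plus the origin, gives 2 * 2 + 1 = 5 roots.\<close>

lemma rhie_lens_2: "\<exists>p q. rhie_lens 2 p q"
proof (rule rhie_lens_small[of 2 0 "1 / 2" "{sqrt (3 / 2)}" "{sqrt (1 / 2)}"])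
  have eq: "s\<^sup>2 * (\<sigma> * s\<^sup>2 - 1 / 2) = \<sigma> * s\<^sup>2 \<longleftrightarrow> \<sigma> * s\<^sup>2 - 1 / 2 = \<sigma>" if "s > 0" for s \<sigma> :: real
  proof -
    have "s\<^sup>2 * (\<sigma> * s\<^sup>2 - 1 / 2) = \<sigma> * s\<^sup>2 \<longleftrightarrow> s\<^sup>2 * (\<sigma> * s\<^sup>2 - 1 / 2) = s\<^sup>2 * \<sigma>"
      by (simp only: mult.commute)
    also have "\<dots> \<longleftrightarrow> \<sigma> * s\<^sup>2 - 1 / 2 = \<sigma>" using that by simp
    finally show ?thesis .
  qed
  have root: "s\<^sup>2 = c \<longleftrightarrow> s = sqrt c" if "s > 0" "c > 0" for s c :: real
    using that by auto
  show "{s::real. s > 0 \<and> s\<^sup>2 * (s ^ 2 - 1 / 2) = s ^ 2} = {sqrt (3 / 2)}"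
  proof (intro set_eqI)
    fix s :: real
    have "s\<^sup>2 * (s ^ 2 - 1 / 2) = s ^ 2 \<longleftrightarrow> s\<^sup>2 = 3 / 2" if "s > 0"
      using eq[OF that, of 1] by auto
    then show "s \<in> {s. s > 0 \<and> s\<^sup>2 * (s ^ 2 - 1 / 2) = s ^ 2} \<longleftrightarrow> s \<in> {sqrt (3 / 2)}"
      using root[of s "3 / 2"] by (cases "s > 0") auto
  qed
  show "{s::real. s > 0 \<and> s\<^sup>2 * (- (s ^ 2) - 1 / 2) = - (s ^ 2)} = {sqrt (1 / 2)}"
  proof (intro set_eqI)
    fix s :: real
    have "s\<^sup>2 * (- (s ^ 2) - 1 / 2) = - (s ^ 2) \<longleftrightarrow> s\<^sup>2 = 1 / 2" if "s > 0"
      using eq[OF that, of "- 1"] by auto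
    then show "s \<in> {s. s > 0 \<and> s\<^sup>2 * (- (s ^ 2) - 1 / 2) = - (s ^ 2)} \<longleftrightarrow> s \<in> {sqrt (1 / 2)}"
      using root[of s "1 / 2"] by (cases "s > 0") auto
  qed
qed auto

text \<open>The value b = 3/8 makes s = -1/2 a root of the cubic s^3 - s = b, so the others are (1 +
  w)/4 and (1 - w)/4 with w = sqrt 13. One positive solution for \<sigma> = 1, two for \<sigma> =
  -1, and the origin give 3 * 3 + 1 = 10 roots.\<close>

lemma rhie_lens_3: "\<exists>p q. rhie_lens 3 p q"
proof -
  define w where "w = sqrt (13::real)"
  have w2: "w * w = 13" by (simp add: w_def)
  have w: "3 < w" "w < 4" by (auto simp: w_def intro: real_less_rsqrt real_less_lsqrt)
  have eq: "s\<^sup>2 * (\<sigma> * s ^ 3 - 3 / 8) = \<sigma> * s ^ 3 \<longleftrightarrow> \<sigma> * s * (s * s - 1) = 3 / 8" if "s > 0" for s \<sigma> :: real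
  proof -
    have "s\<^sup>2 * (\<sigma> * s ^ 3 - 3 / 8) - \<sigma> * s ^ 3 = s\<^sup>2 * (\<sigma> * s * (s * s - 1) - 3 / 8)"
      by (simp add: algebra_simps power2_eq_square power3_eq_cube)
    then show ?thesis using that by (metis eq_iff_diff_eq_0 mult_eq_0_iff power_eq_0_iff less_irrefl)
  qed
  have pos: "s * (s * s - 1) = 3 / 8 \<longleftrightarrow> s = (w + 1) / 4" if "s > 0" for s
  proof -
    have "s * (s * s - 1) - 3 / 8 = (s + 1 / 2) * ((s - (1 + w) / 4) * (s - (1 - w) / 4))"
      using w2 by (simp add: field_simps)
    moreover have "s + 1 / 2 \<noteq> 0" "s - (1 - w) / 4 \<noteq> 0" using that w by auto
    ultimately have "s * (s * s - 1) - 3 / 8 = 0 \<longleftrightarrow> s - (1 + w) / 4 = 0"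
      by (simp only: mult_eq_0_iff simp_thms)
    then show ?thesis by (simp only: right_minus_eq add.commute[of 1 w])
  qed
  have neg: "- s * (s * s - 1) = 3 / 8 \<longleftrightarrow> s = 1 / 2 \<or> s = (w - 1) / 4" if "s > 0" for s
  proof -
    have "- s * (s * s - 1) - 3 / 8 = - (s - 1 / 2) * ((s + (1 + w) / 4) * (s - (w - 1) / 4))"
      using w2 by (simp add: field_simps)
    moreover have "(1 + w) / 4 > 0" using w by simp
    then have "s + (1 + w) / 4 > 0" using that by (intro add_pos_pos)
    then have "s + (1 + w) / 4 \<noteq> 0" by simp
    ultimately have "- s * (s * s - 1) - 3 / 8 = 0 \<longleftrightarrow> s - 1 / 2 = 0 \<or> s - (w - 1) / 4 = 0"
      by (simp only: mult_eq_0_iff neg_equal_0_iff_equal simp_thms)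
    then show ?thesis by (simp only: right_minus_eq)
  qed
  show ?thesis
  proof (rule rhie_lens_small[of 3 1 "3 / 8" "{(w + 1) / 4}" "{1 / 2, (w - 1) / 4}"])
    show "{s::real. s > 0 \<and> s\<^sup>2 * (s ^ 3 - 3 / 8) = s ^ 3} = {(w + 1) / 4}"
      using eq[of _ 1] pos w by auto
    show "{s::real. s > 0 \<and> s\<^sup>2 * (- (s ^ 3) - 3 / 8) = - (s ^ 3)} = {1 / 2, (w - 1) / 4}"
      using eq[of _ "- 1"] neg w by auto
    show "3 * (card {(w + 1) / 4} + card {1 / 2, (w - 1) / 4}) + 1 = 5 * 3 - 5"
      using w by (simp add: card_insert_if)
    fix s assume s: "s \<in> {(w + 1) / 4} \<union> {1 / 2, (w - 1) / 4}"
    show "real 3 * s\<^sup>2 \<noteq> real 1"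
    proof
      assume e: "real 3 * s\<^sup>2 = real 1"
      from s consider "s = (w + 1) / 4" | "s = 1 / 2" | "s = (w - 1) / 4" by auto
      then show False
      proof cases
        case 1
        then have "4 * s = w + 1" by simp
        moreover have "16 * s\<^sup>2 = (4 * s) * (4 * s)" by (simp add: power2_eq_square)
        ultimately have "16 * s\<^sup>2 = (w + 1) * (w + 1)" by simp
        also have "\<dots> = 14 + 2 * w" using w2 by (simp add: algebra_simps)
        finally have "3 * (14 + 2 * w) = 16" using e by simp
        then show False using w by simp
      next
        case 2
        show False using e unfolding 2 by (simp add: power2_eq_square)
      next
        case 3
        then have "4 * s = w - 1" by simp
        moreover have "16 * s\<^sup>2 = (4 * s) * (4 * s)" by (simp add: power2_eq_square)
        ultimately have "16 * s\<^sup>2 = (w - 1) * (w - 1)" by simp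
        also have "\<dots> = 14 - 2 * w" using w2 by (simp add: algebra_simps)
        finally have "3 * (14 - 2 * w) = 16" using e by simp
        then have "w = 13 / 3" by simp
        then show False using w by simp
      qed
    qed
  qed auto
qed

lemma rhie_lens_exists:
  assumes "n \<ge> 2"
  shows "\<exists>p q. rhie_lens n p q"
proof -
  consider "n = 2" | "n = 3" | "n - 1 \<ge> 3" using assms by linarith
  then show ?thesis
    using rhie_lens_2 rhie_lens_3 rhie_lens_large[of "n - 1"] assms by cases auto
qed

section \<open>The counting theorem\<close>

text \<open>What remains is relabelling by natural numbers. The bound t0 precedes the choice of the
  enumeration \<alpha>, because \<open>roots_of_deformation\<close> does not refer to one.\<close>

lemma simple_lens_deformation:
  assumes n: "n \<ge> 2" and m: "m \<ge> 1" and pq: "simple_lens n p q"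
  shows "finite (mixed_roots (lens_poly p q)) \<and>
      (\<exists>t0 > 0.
        (\<forall>t. 0 < norm t \<and> norm t < t0 \<longrightarrow>
           finite (mixed_roots (lens_deform m (coeff q n) p q t)) \<and>
           all_roots_simple (lens_deform m (coeff q n) p q t) \<and>
           \<rho> (lens_deform m (coeff q n) p q t) = \<rho> (lens_poly p q) + m - 1) \<and>
        (\<forall>\<alpha> :: nat \<Rightarrow> complex.
           bij_betw \<alpha> {1..\<rho> (lens_poly p q)} (mixed_roots (lens_poly p q)) \<longrightarrow>
           (\<exists>(A :: nat \<Rightarrow> complex \<Rightarrow> complex) (B :: nat \<Rightarrow> complex \<Rightarrow> complex).
              (\<forall>t. 0 < norm t \<and> norm t < t0 \<longrightarrow>
                 bij_betw (case_sum (\<lambda>j. A j t) (\<lambda>a. B a t))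
                   ({1..\<rho> (lens_poly p q)} <+> {1..m - 1})
                   (mixed_roots (lens_deform m (coeff q n) p q t))) \<and>
              (\<forall>j \<in> {1..\<rho> (lens_poly p q)}.
                 (A j \<longlongrightarrow> \<alpha> j) (at 0) \<and>
                 (\<forall>t. 0 < norm t \<and> norm t < t0 \<longrightarrow>
                    root_sign (lens_deform m (coeff q n) p q t) (A j t)
                      = root_sign (lens_poly p q) (\<alpha> j))) \<and>
              (\<forall>a \<in> {1..m - 1}.
                 filterlim (B a) at_infinity (at 0) \<and>
                 (\<forall>t. 0 < norm t \<and> norm t < t0 \<longrightarrow>
                    negative_simple_root (lens_deform m (coeff q n) p q t) (B a t))))))"
proof -
  have deg: "degree q = n" "degree p \<le> n" and simple: "all_roots_simple (lens_poly p q)"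
    using pq by (auto simp: simple_lens_def)
  have "q \<noteq> 0" using deg n by auto
  with deg m interpret lens_deformation n m p q "coeff q n"
    by unfold_locales auto
  define Z where "Z = mixed_roots (lens_poly p q)"
  have finZ: "finite Z" using finite_roots simple by (simp add: \<Phi>_0 Z_def)
  have cardZ: "\<rho> (lens_poly p q) = card Z" by (simp add: root_count_def Z_def)
  have "all_roots_simple (\<Phi> 0)" using simple by (simp add: \<Phi>_0)
  then obtain r :: "complex + complex \<Rightarrow> complex \<Rightarrow> complex" and t0 :: real where t0: "t0 > 0"
    "\<And>t. 0 < norm t \<Longrightarrow> norm t < t0 \<Longrightarrow>
       bij_betw (\<lambda>i. r i t) (mixed_roots (\<Phi> 0) <+> far_centers) (mixed_roots (\<Phi> t))"
    "\<And>\<alpha>. \<alpha> \<in> mixed_roots (\<Phi> 0) \<Longrightarrow> (r (Inl \<alpha>) \<longlongrightarrow> \<alpha>) (at 0)"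
    "\<And>\<alpha> t. \<alpha> \<in> mixed_roots (\<Phi> 0) \<Longrightarrow> 0 < norm t \<Longrightarrow> norm t < t0 \<Longrightarrow>
       sgn (mixed_jacobian (\<Phi> t) (r (Inl \<alpha>) t)) = sgn (mixed_jacobian (\<Phi> 0) \<alpha>)"
    and far: "\<And>V. V \<in> far_centers \<Longrightarrow> filterlim (r (Inr V)) at_infinity (at 0)"
      "\<And>V t. V \<in> far_centers \<Longrightarrow> 0 < norm t \<Longrightarrow> norm t < t0 \<Longrightarrow>
       mixed_jacobian (\<Phi> t) (r (Inr V) t) < 0"
    by (rule roots_of_deformation) blast
  note bij = t0(2)[unfolded \<Phi>_0, folded Z_def] and near = t0(3,4)[unfolded \<Phi>_0, folded Z_def]
  have \<Phi>: "lens_deform m (coeff q n) p q t = \<Phi> t" if "0 < norm t" for t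
    using that by (intro \<Phi>_deform) auto
  have roots: "finite (mixed_roots (\<Phi> t)) \<and> all_roots_simple (\<Phi> t) \<and> \<rho> (\<Phi> t) = card Z + m - 1"
    if t: "0 < norm t" "norm t < t0" for t
  proof (intro conjI)
    show "finite (mixed_roots (\<Phi> t))"
      using bij_betw_finite[OF bij[OF t]] finZ finite_far_centers by simp
    show "\<rho> (\<Phi> t) = card Z + m - 1"
      using bij_betw_same_card[OF bij[OF t]] finZ finite_far_centers card_far_centers m
      by (simp add: root_count_def card_Plus)
    have nz: "mixed_jacobian (lens_poly p q) \<alpha> \<noteq> 0" if "\<alpha> \<in> Z" for \<alpha>
      using simple that by (auto simp: all_roots_simple_def simple_root_iff Z_def)
    have "mixed_jacobian (\<Phi> t) z \<noteq> 0" if "z \<in> mixed_roots (\<Phi> t)" for z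
    proof -
      from that obtain i where i: "i \<in> Z <+> far_centers" "z = r i t"
        unfolding bij_betw_imp_surj_on[OF bij[OF t], symmetric] by blast
      from i(1) show ?thesis
      proof (elim PlusE)
        fix \<alpha> assume "\<alpha> \<in> Z" "i = Inl \<alpha>"
        then show ?thesis using near(2)[OF _ t] nz i(2) by (metis sgn_zero_iff)
      next
        fix V assume "V \<in> far_centers" "i = Inr V"
        then show ?thesis using far(2)[OF _ t, of V] i(2) by simp
      qed
    qed
    then show "all_roots_simple (\<Phi> t)"
      by (auto simp: all_roots_simple_def simple_root_iff mixed_roots_def)
  qed
  \<comment> \<open>For m = 1 both sides are empty and no root is born at infinity.\<close>
  obtain v where v: "bij_betw v {1..m - 1} far_centers"
    using ex_bij_betw_nat_finite_1[OF finite_far_centers] card_far_centers by auto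
  have labels: "\<exists>(A :: nat \<Rightarrow> complex \<Rightarrow> complex) (B :: nat \<Rightarrow> complex \<Rightarrow> complex).
      (\<forall>t. 0 < norm t \<and> norm t < t0 \<longrightarrow>
         bij_betw (case_sum (\<lambda>j. A j t) (\<lambda>a. B a t)) ({1..card Z} <+> {1..m - 1})
           (mixed_roots (lens_deform m (coeff q n) p q t))) \<and>
      (\<forall>j \<in> {1..card Z}. (A j \<longlongrightarrow> \<alpha> j) (at 0) \<and>
         (\<forall>t. 0 < norm t \<and> norm t < t0 \<longrightarrow>
            root_sign (lens_deform m (coeff q n) p q t) (A j t) = root_sign (lens_poly p q) (\<alpha> j))) \<and>
      (\<forall>a \<in> {1..m - 1}. filterlim (B a) at_infinity (at 0) \<and>
         (\<forall>t. 0 < norm t \<and> norm t < t0 \<longrightarrow>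
            negative_simple_root (lens_deform m (coeff q n) p q t) (B a t)))"
    if \<alpha>: "bij_betw \<alpha> {1..card Z} Z" for \<alpha> :: "nat \<Rightarrow> complex"
  proof (intro exI conjI allI ballI impI)
    fix t :: complex assume t: "0 < norm t \<and> norm t < t0"
    have "inj_on (map_sum \<alpha> v) ({1..card Z} <+> {1..m - 1})"
    proof (rule inj_onI)
      fix x y assume xy: "x \<in> {1..card Z} <+> {1..m - 1}" "y \<in> {1..card Z} <+> {1..m - 1}"
        "map_sum \<alpha> v x = map_sum \<alpha> v y"
      then show "x = y"
        using inj_onD[OF bij_betw_imp_inj_on[OF \<alpha>]] inj_onD[OF bij_betw_imp_inj_on[OF v]]
        by (elim PlusE) auto
    qed
    moreover have "map_sum \<alpha> v ` ({1..card Z} <+> {1..m - 1}) = \<alpha> ` {1..card Z} <+> v ` {1..m - 1}"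
      by (simp add: Plus_def image_Un image_image)
    ultimately have "bij_betw (map_sum \<alpha> v) ({1..card Z} <+> {1..m - 1}) (Z <+> far_centers)"
      using \<alpha> v by (simp only: bij_betw_def)
    from bij_betw_trans[OF this bij] t
    have "bij_betw ((\<lambda>i. r i t) \<circ> map_sum \<alpha> v) ({1..card Z} <+> {1..m - 1}) (mixed_roots (\<Phi> t))"
      by blast
    moreover have "(\<lambda>i. r i t) \<circ> map_sum \<alpha> v = case_sum (\<lambda>j. r (Inl (\<alpha> j)) t) (\<lambda>a. r (Inr (v a)) t)"
      by (auto simp: fun_eq_iff split: sum.splits)
    ultimately show "bij_betw (case_sum (\<lambda>j. r (Inl (\<alpha> j)) t) (\<lambda>a. r (Inr (v a)) t))
        ({1..card Z} <+> {1..m - 1}) (mixed_roots (lens_deform m (coeff q n) p q t))"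
      using t \<Phi> by simp
  next
    fix j assume "j \<in> {1..card Z}"
    then have "\<alpha> j \<in> Z" using \<alpha> bij_betwE by blast
    then show "(r (Inl (\<alpha> j)) \<longlongrightarrow> \<alpha> j) (at 0)" by (rule near)
    fix t :: complex assume "0 < norm t \<and> norm t < t0"
    then show "root_sign (lens_deform m (coeff q n) p q t) (r (Inl (\<alpha> j)) t) = root_sign (lens_poly p q) (\<alpha> j)"
      using near(2)[OF \<open>\<alpha> j \<in> Z\<close>] \<Phi> by (simp add: root_sign_def)
  next
    fix a assume a: "a \<in> {1..m - 1}"
    then have V: "v a \<in> far_centers" using v bij_betwE by blast
    then show "filterlim (r (Inr (v a))) at_infinity (at 0)" by (rule far)
    fix t :: complex assume t: "0 < norm t \<and> norm t < t0"
    have "r (Inr (v a)) t \<in> mixed_roots (\<Phi> t)"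
      using bij_betwE[OF bij[of t]] t V by auto
    then show "negative_simple_root (lens_deform m (coeff q n) p q t) (r (Inr (v a)) t)"
      using far(2)[OF V, of t] t \<Phi> by (simp add: negative_simple_root_def)
  qed
  show ?thesis
    unfolding cardZ Z_def[symmetric]
    using finZ t0(1) roots labels \<Phi> by (intro conjI exI[of _ t0]) auto
qed

theorem theorem4:
  fixes n m :: nat
  assumes "n \<ge> 2" and "m \<ge> 1"
  shows "(\<forall>p q. simple_lens n p q \<longrightarrow>
      finite (mixed_roots (lens_poly p q)) \<and>
      (\<exists>t0 > 0.
        (\<forall>t. 0 < norm t \<and> norm t < t0 \<longrightarrow>
           finite (mixed_roots (lens_deform m (coeff q n) p q t)) \<and>
           all_roots_simple (lens_deform m (coeff q n) p q t) \<and>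
           \<rho> (lens_deform m (coeff q n) p q t) = \<rho> (lens_poly p q) + m - 1) \<and>
        (\<forall>\<alpha> :: nat \<Rightarrow> complex.
           bij_betw \<alpha> {1..\<rho> (lens_poly p q)} (mixed_roots (lens_poly p q)) \<longrightarrow>
           (\<exists>(A :: nat \<Rightarrow> complex \<Rightarrow> complex) (B :: nat \<Rightarrow> complex \<Rightarrow> complex).
              (\<forall>t. 0 < norm t \<and> norm t < t0 \<longrightarrow>
                 bij_betw (case_sum (\<lambda>j. A j t) (\<lambda>a. B a t))
                   ({1..\<rho> (lens_poly p q)} <+> {1..m - 1})
                   (mixed_roots (lens_deform m (coeff q n) p q t))) \<and>
              (\<forall>j \<in> {1..\<rho> (lens_poly p q)}.
                 (A j \<longlongrightarrow> \<alpha> j) (at 0) \<and>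
                 (\<forall>t. 0 < norm t \<and> norm t < t0 \<longrightarrow>
                    root_sign (lens_deform m (coeff q n) p q t) (A j t)
                      = root_sign (lens_poly p q) (\<alpha> j))) \<and>
              (\<forall>a \<in> {1..m - 1}.
                 filterlim (B a) at_infinity (at 0) \<and>
                 (\<forall>t. 0 < norm t \<and> norm t < t0 \<longrightarrow>
                    negative_simple_root (lens_deform m (coeff q n) p q t) (B a t)))))))
    \<and> (\<exists>p q. rhie_lens n p q)
    \<and> (\<forall>p q. rhie_lens n p q \<longrightarrow>
        (\<exists>t0 > 0. \<forall>t. 0 < norm t \<and> norm t < t0 \<longrightarrow>
           \<rho> (lens_deform m (coeff q n) p q t) = 5 * n + m - 6))"
proof (rule conjI[OF _ conjI], goal_cases)
  case 1
  show ?case by (intro allI impI simple_lens_deformation assms)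
next
  \<comment> \<open>Existence in every degree n \<ge> 2 shows that the final claim about
    \<open>rhie_lens\<close> is not vacuous.\<close>
  case 2
  show ?case using assms(1) by (rule rhie_lens_exists)
next
  case 3
  show ?case
  proof (intro allI impI)
    fix p q assume "rhie_lens n p q"
    then have "simple_lens n p q" "\<rho> (lens_poly p q) = 5 * n - 5" by (simp_all add: rhie_lens_def)
    \<comment> \<open>Subtraction of naturals is truncated; n \<ge> 2 and m \<ge> 1 make it exact
      here.\<close>
    moreover have "5 * n - 5 + m - 1 = 5 * n + m - 6" using assms by simp
    ultimately obtain t0 where "t0 > 0"
      "\<And>t. 0 < norm t \<Longrightarrow> norm t < t0 \<Longrightarrow> \<rho> (lens_deform m (coeff q n) p q t) = 5 * n + m - 6"
      using simple_lens_deformation[OF assms] by metis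
    then show "\<exists>t0 > 0. \<forall>t. 0 < norm t \<and> norm t < t0 \<longrightarrow>
        \<rho> (lens_deform m (coeff q n) p q t) = 5 * n + m - 6"
      by blast
  qed
qed

end
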